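(* Let $M$ be a matroid on a finite linearly ordered set $E$. Then $$\{\text{bases of }M\}=\biguplus\Bigl\{B'_1\uplus\dots\uplus B'_\varepsilon\uplus B_1\uplus\dots\uplus B_\iota\ \Big|\ B'_k\text{ basis of }M(F'_{k-1})/F'_k\text{ with internal activity }0\text{ and external activity }1\text{ for all }1\le k\le\varepsilon,$$ $$\qquad\qquad B_k\text{ basis of }M(F_k)/F_{k-1}\text{ with internal activity }1\text{ and external activity }0\text{ for all }1\le k\le\iota\Bigr\},$$ where the disjoint union is over all connected filtrations $\emptyset=F'_\varepsilon\subset\dots\subset F'_0=F_c=F_0\subset\dots\subset F_\iota=E$ of $M$. Moreover, for a connected filtration $\emptyset=F'_\varepsilon\subset\dots\subset F'_0=F_c=F_0\subset\dots\subset F_\iota=E$ of $M$, bases $B'_k$ of $M(F'_{k-1})/F'_k$ with internal activity $0$ and external activity $1$ for all $1\le k\le\varepsilon$, bases $B_k$ of $M(F_k)/F_{k-1}$ with internal activity $1$ and external activity $0$ for all $1\le k\le\iota$, and $B=B'_1\uplus\dots\uplus B'_\varepsilon\uplus B_1\uplus\dots\uplus B_\iota$, one has $$\mathrm{Int}(B)=\bigcup_{1\le k\le\iota}\{\min(F_k\setminus F_{k-1})\}=\bigcup_{1\le k\le\iota}\mathrm{Int}(B_k),$$ $$\mathrm{Ext}(B)=\bigcup_{1\le k\le\varepsilon}\{\min(F'_{k-1}\setminus F'_k)\}=\bigcup_{1\le k\le\varepsilon}\mathrm{Ext}(B'_k),$$ where $\mathrm{Int}(B_k)$ and $\mathrm{Ext}(B'_k)$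 are computed in the respective minors. Furthermore, the connected filtration associated to the basis $B$ in the right-hand side of the first equality is the active filtration of $B$.
   Context: $\subset$ denotes strict inclusion, $\uplus$ disjoint union. For $A\subseteq G\subseteq E$, $M(G)/A$ is the minor obtained by restricting $M$ to $G$ and contracting $A$, with the induced order on its ground set. A matroid is called an isthmus, resp. a loop, if it has exactly one element and that element is a coloop, resp. a loop. One-element matroids are connected. For a basis $B$ of an ordered matroid $M$: for $b\in B$, $C^*(B;b)$ is the fundamental cocircuit (the unique cocircuit contained in $(E\setminus B)\cup\{b\}$), and for $e\in E\setminus B$, $C(B;e)$ is the fundamental circuit (the unique circuit contained in $B\cup\{e\}$). $\mathrm{Int}(B)=\{b\in B: b=\min C^*(B;b)\}$ and $\mathrm{Ext}(B)=\{e\in E\setminus B: e=\min C(B;e)\}$; their cardinalities are the internal and external activity of $B$. Filtrations. A filtration of $M$ is a sequence $(F'_\varepsilon,\dots,F'_0,F_c,F_0,\dots,F_\iota)$ of subsets of $E$ ($\iota,\varepsilon\ge 0$) such that $\emptyset=F'_\varepsilon\subset\dots\subset F'_0=F_c=F_0\subset\dots\subset F_\iota=E$, the sequence $\min(F_k\setminus F_{k-1})$, $1\le k\le\iota$, is increasing with $k$, and the sequence $\min(F'_{k-1}\setminus F'_k)$, $1\le k\le\varepsilon$, is increasing with $k$. It is a connected filtration of $M$ if in addition $M(F_k)/F_{k-1}$ is connected and not a loop for $1\le k\le\iota$, and $M(F'_{k-1})/F'_k$ is connected and not an isthmus for $1\le k\le\varepsilon$. Active closure. For $b\in B$ let $C^*(B;b)^<=\{e\in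 C^*(B;b): e<b\}$, and for $e\in E\setminus B$ let $C(B;e)^<=\{b\in C(B;e): b<e\}$. For $X\subseteq\mathrm{Int}(B)$, $\mathrm{acl}(X)$ is the smallest subset of $E$ (for inclusion) such that $X\subseteq\mathrm{acl}(X)$; if $b\in B\cap\mathrm{acl}(X)$ then $C^*(B;b)\subseteq\mathrm{acl}(X)$; and if $b\in B$ and $\emptyset\ne C^*(B;b)^<\subseteq\mathrm{acl}(X)$ then $b\in\mathrm{acl}(X)$. For $X\subseteq\mathrm{Ext}(B)$, $\mathrm{acl}(X)$ is the smallest subset of $E$ such that $X\subseteq\mathrm{acl}(X)$; if $e\in (E\setminus B)\cap\mathrm{acl}(X)$ then $C(B;e)\subseteq\mathrm{acl}(X)$; and if $e\in E\setminus B$ and $\emptyset\ne C(B;e)^<\subseteq\mathrm{acl}(X)$ then $e\in\mathrm{acl}(X)$. Active filtration. Let $a_1<\dots<a_\iota$ be the elements of $\mathrm{Int}(B)$ and $a'_1<\dots<a'_\varepsilon$ those of $\mathrm{Ext}(B)$. The active filtration of $B$ is the sequence $(F'_\varepsilon,\dots,F'_0,F_c,F_0,\dots,F_\iota)$ with $F_c=\mathrm{acl}(\mathrm{Ext}(B))=E\setminus\mathrm{acl}(\mathrm{Int}(B))$ (these two sets are equal); $F_\iota=E$ and $F_k=E\setminus\mathrm{acl}(\{a_{k+1},\dots,a_\iota\})$ for $0\le k\le\iota-1$; $F'_\varepsilon=\emptyset$ and $F'_k=\mathrm{acl}(\{a'_{k+1},\dots,a'_\varepsilon\})$ for $0\le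 k\le\varepsilon-1$ (and $F_0=F'_0=F_c$). *)

theory Defs
  imports "HOL-Library.Disjoint_Sets"
begin

section \<open>Matroids\<close>

text \<open>
  A matroid is a finite ground set together with its family of independent sets. The elements live
  in a type of class \<^class>\<open>linorder\<close>, so the ground set, and with it the ground set of every minor,
  carries the induced linear order.
\<close>

record 'a matroid =
  ground :: "'a set"
  indeps :: "'a set set"

definition is_matroid :: "'a matroid \<Rightarrow> bool" where
  "is_matroid M \<longleftrightarrow>
     finite (ground M) \<and>
     indeps M \<subseteq> Pow (ground M) \<and>
     {} \<in> indeps M \<and>
     (\<forall>X Y. Y \<in> indeps M \<and> X \<subseteq> Y \<longrightarrow> X \<in> indeps M) \<and>
     (\<forall>X Y. X \<in> indeps M \<and> Y \<in> indeps M \<and> card X < card Y \<longrightarrow>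
        (\<exists>y \<in> Y - X. insert y X \<in> indeps M))"

definition basis :: "'a matroid \<Rightarrow> 'a set \<Rightarrow> bool" where
  "basis M B \<longleftrightarrow> B \<in> indeps M \<and> (\<forall>X \<in> indeps M. B \<subseteq> X \<longrightarrow> X = B)"

definition circuit :: "'a matroid \<Rightarrow> 'a set \<Rightarrow> bool" where
  "circuit M C \<longleftrightarrow> C \<subseteq> ground M \<and> C \<notin> indeps M \<and> (\<forall>X. X \<subset> C \<longrightarrow> X \<in> indeps M)"

definition dual :: "'a matroid \<Rightarrow> 'a matroid" where
  "dual M = \<lparr>ground = ground M,
             indeps = {X. X \<subseteq> ground M \<and> (\<exists>B. basis M B \<and> X \<inter> B = {})}\<rparr>"

definition cocircuit :: "'a matroid \<Rightarrow> 'a set \<Rightarrow> bool" where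
  "cocircuit M D \<longleftrightarrow> circuit (dual M) D"

definition restriction :: "'a matroid \<Rightarrow> 'a set \<Rightarrow> 'a matroid" where
  "restriction M G = \<lparr>ground = G, indeps = {X \<in> indeps M. X \<subseteq> G}\<rparr>"

definition contraction :: "'a matroid \<Rightarrow> 'a set \<Rightarrow> 'a matroid" where
  "contraction M A =
     \<lparr>ground = ground M - A,
      indeps = {X. X \<subseteq> ground M - A \<and> (\<exists>J. basis (restriction M A) J \<and> X \<union> J \<in> indeps M)}\<rparr>"

text \<open>\<open>minor M G A\<close> is $M(G)/A$; it is only used for $A \subseteq G \subseteq E$.\<close>

definition minor :: "'a matroid \<Rightarrow> 'a set \<Rightarrow> 'a set \<Rightarrow> 'a matroid" where
  "minor M G A = contraction (restriction M G) A"

text \<open>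
  Connectedness in the sense of the usual equivalence relation (two elements are related if they are
  equal or lie on a common circuit). One-element matroids are connected.
\<close>

definition connected_matroid :: "'a matroid \<Rightarrow> bool" where
  "connected_matroid M \<longleftrightarrow>
     (\<forall>e \<in> ground M. \<forall>f \<in> ground M. e \<noteq> f \<longrightarrow> (\<exists>C. circuit M C \<and> e \<in> C \<and> f \<in> C))"

definition is_loop :: "'a matroid \<Rightarrow> bool" where
  "is_loop M \<longleftrightarrow> (\<exists>e. ground M = {e} \<and> circuit M {e})"

definition is_isthmus :: "'a matroid \<Rightarrow> bool" where
  "is_isthmus M \<longleftrightarrow> (\<exists>e. ground M = {e} \<and> cocircuit M {e})"


section \<open>Activities of bases\<close>

definition fund_cocircuit :: "'a matroid \<Rightarrow> 'a set \<Rightarrow> 'a \<Rightarrow> 'a set" where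
  "fund_cocircuit M B b = (THE D. cocircuit M D \<and> D \<subseteq> (ground M - B) \<union> {b})"

definition fund_circuit :: "'a matroid \<Rightarrow> 'a set \<Rightarrow> 'a \<Rightarrow> 'a set" where
  "fund_circuit M B e = (THE C. circuit M C \<and> C \<subseteq> B \<union> {e})"

definition int_set :: "'a::linorder matroid \<Rightarrow> 'a set \<Rightarrow> 'a set" where
  "int_set M B = {b \<in> B. b = Min (fund_cocircuit M B b)}"

definition ext_set :: "'a::linorder matroid \<Rightarrow> 'a set \<Rightarrow> 'a set" where
  "ext_set M B = {e \<in> ground M - B. e = Min (fund_circuit M B e)}"

definition int_activity :: "'a::linorder matroid \<Rightarrow> 'a set \<Rightarrow> nat" where
  "int_activity M B = card (int_set M B)"

definition ext_activity :: "'a::linorder matroid \<Rightarrow> 'a set \<Rightarrow> nat" where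
  "ext_activity M B = card (ext_set M B)"


section \<open>Filtrations\<close>

text \<open>
  The sequence $(F'_\varepsilon,\dots,F'_0,F_c,F_0,\dots,F_\iota)$ is encoded as the triple of the
  list $[F'_0,\dots,F'_\varepsilon]$ (note the order), the set $F_c$, and the list
  $[F_0,\dots,F_\iota]$. Both lists are non-empty and $F'_k$, $F_k$ are their entries number $k$.
  Lists, rather than functions on the natural numbers, make equality of filtrations the right one.
\<close>

type_synonym 'a filt = "'a set list \<times> 'a set \<times> 'a set list"

definition filtration :: "'a::linorder matroid \<Rightarrow> 'a filt \<Rightarrow> bool" where
  "filtration M = (\<lambda>(F', Fc, F). \<exists>\<epsilon> \<iota>.
     length F' = \<epsilon> + 1 \<and> length F = \<iota> + 1 \<and>
     F' ! \<epsilon> = {} \<and>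
     (\<forall>k \<in> {1..\<epsilon>}. F' ! k \<subset> F' ! (k - 1)) \<and>
     F' ! 0 = Fc \<and> Fc = F ! 0 \<and>
     (\<forall>k \<in> {1..\<iota>}. F ! (k - 1) \<subset> F ! k) \<and>
     F ! \<iota> = ground M \<and>
     strict_mono_on {1..\<iota>} (\<lambda>k. Min (F ! k - F ! (k - 1))) \<and>
     strict_mono_on {1..\<epsilon>} (\<lambda>k. Min (F' ! (k - 1) - F' ! k)))"

definition connected_filtration :: "'a::linorder matroid \<Rightarrow> 'a filt \<Rightarrow> bool" where
  "connected_filtration M = (\<lambda>(F', Fc, F).
     filtration M (F', Fc, F) \<and>
     (\<forall>k \<in> {1..length F - 1}.
        connected_matroid (minor M (F ! k) (F ! (k - 1))) \<and>
        \<not> is_loop (minor M (F ! k) (F ! (k - 1)))) \<and>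
     (\<forall>k \<in> {1..length F' - 1}.
        connected_matroid (minor M (F' ! (k - 1)) (F' ! k)) \<and>
        \<not> is_isthmus (minor M (F' ! (k - 1)) (F' ! k))))"

text \<open>
  \<open>minor_bases M \<F> B' B\<close>: the sets $B'_k$ ($1 \le k \le \varepsilon$) and $B_k$
  ($1 \le k \le \iota$) are bases of the minors of the filtration with the prescribed activities.
  Values of the two functions at other indices are irrelevant.
\<close>

definition minor_bases ::
    "'a::linorder matroid \<Rightarrow> 'a filt \<Rightarrow> (nat \<Rightarrow> 'a set) \<Rightarrow> (nat \<Rightarrow> 'a set) \<Rightarrow> bool" where
  "minor_bases M = (\<lambda>(F', Fc, F) B' B.
     (\<forall>k \<in> {1..length F' - 1}.
        basis (minor M (F' ! (k - 1)) (F' ! k)) (B' k) \<and>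
        int_activity (minor M (F' ! (k - 1)) (F' ! k)) (B' k) = 0 \<and>
        ext_activity (minor M (F' ! (k - 1)) (F' ! k)) (B' k) = 1) \<and>
     (\<forall>k \<in> {1..length F - 1}.
        basis (minor M (F ! k) (F ! (k - 1))) (B k) \<and>
        int_activity (minor M (F ! k) (F ! (k - 1))) (B k) = 1 \<and>
        ext_activity (minor M (F ! k) (F ! (k - 1))) (B k) = 0))"

definition union_of_parts ::
    "'a filt \<Rightarrow> (nat \<Rightarrow> 'a set) \<Rightarrow> (nat \<Rightarrow> 'a set) \<Rightarrow> 'a set" where
  "union_of_parts = (\<lambda>(F', Fc, F) B' B.
     (\<Union>k \<in> {1..length F' - 1}. B' k) \<union> (\<Union>k \<in> {1..length F - 1}. B k))"

definition parts_disjoint ::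
    "'a filt \<Rightarrow> (nat \<Rightarrow> 'a set) \<Rightarrow> (nat \<Rightarrow> 'a set) \<Rightarrow> bool" where
  "parts_disjoint = (\<lambda>(F', Fc, F) B' B.
     disjoint_family_on B' {1..length F' - 1} \<and>
     disjoint_family_on B {1..length F - 1} \<and>
     (\<forall>i \<in> {1..length F' - 1}. \<forall>j \<in> {1..length F - 1}. B' i \<inter> B j = {}))"


section \<open>Active closure and active filtration\<close>

text \<open>
  The two versions are kept apart since $X = \emptyset$ is a subset of both Int(B) and Ext(B). In both
  cases the conditions are stable under intersection, so that the least set exists.
\<close>

definition acl_int :: "'a::linorder matroid \<Rightarrow> 'a set \<Rightarrow> 'a set \<Rightarrow> 'a set" where
  "acl_int M B X = (LEAST A. A \<subseteq> ground M \<and> X \<subseteq> A \<and>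
     (\<forall>b \<in> B \<inter> A. fund_cocircuit M B b \<subseteq> A) \<and>
     (\<forall>b \<in> B. {e \<in> fund_cocircuit M B b. e < b} \<noteq> {} \<and>
        {e \<in> fund_cocircuit M B b. e < b} \<subseteq> A \<longrightarrow> b \<in> A))"

definition acl_ext :: "'a::linorder matroid \<Rightarrow> 'a set \<Rightarrow> 'a set \<Rightarrow> 'a set" where
  "acl_ext M B X = (LEAST A. A \<subseteq> ground M \<and> X \<subseteq> A \<and>
     (\<forall>e \<in> (ground M - B) \<inter> A. fund_circuit M B e \<subseteq> A) \<and>
     (\<forall>e \<in> ground M - B. {b \<in> fund_circuit M B e. b < e} \<noteq> {} \<and>
        {b \<in> fund_circuit M B e. b < e} \<subseteq> A \<longrightarrow> e \<in> A))"

text \<open>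
  Dropping the first $k$ entries of the sorted list $a_1 < \dots < a_\iota$ of Int(B) leaves
  $a_{k+1},\dots,a_\iota$, and likewise for Ext(B). Of the two equal expressions for $F_c$ the first
  is used; for a filtration, $F_0 = F_c$ also gives the second, $E \setminus$ acl(Int(B)).
\<close>

definition active_filtration :: "'a::linorder matroid \<Rightarrow> 'a set \<Rightarrow> 'a filt" where
  "active_filtration M B =
     (let a = sorted_list_of_set (int_set M B); \<iota> = length a;
          a' = sorted_list_of_set (ext_set M B); \<epsilon> = length a'
      in (map (\<lambda>k. if k = \<epsilon> then {} else acl_ext M B (set (drop k a'))) [0..<\<epsilon> + 1],
          acl_ext M B (ext_set M B),
          map (\<lambda>k. if k = \<iota> then ground M else ground M - acl_int M B (set (drop k a)))
            [0..<\<iota> + 1]))"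

end

theory Submission
  imports Defs
begin

text \<open>
  Everything is read off the bipartite fundamental graph of a basis $B$, where $b \<in> B$ and
  $e \<notin> B$ are adjacent if $B - b + e$ is a basis: fundamental circuits and cocircuits are
  neighbourhoods, and an element is active if it is smaller than all its neighbours. Label the
  elements by integers so that $F_k$ and $F'_k$ are the sets of elements with label at most $k$ and
  at most $-k$. For the active filtration the label of the $k$-th internally (externally) active
  element is $k$ (respectively $1 - k$), a non-active element of $B$ gets the least label of its
  smaller neighbours, and a non-active element outside $B$ the greatest one. Labels then increase
  along edges from $B$ to its complement, so that $B$ induces bases of the minors and the fundamental
  graphs of the minors are the induced subgraphs; every element other than the least one of its
  label has a smaller neighbour with the same label, so that each minor is connected and uniactive.
  Conversely, since the least element of any matroid is active, uniactive bases of the minors of a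
  filtration force its labelling to have these properties, and they determine activities and active
  closures.
\<close>

section \<open>Independent sets, bases and minors\<close>

context
  fixes M :: "'a matroid"
  assumes M: "is_matroid M"
begin

lemma finite_ground: "finite (ground M)"
  using M by (simp add: is_matroid_def)

lemma indep_ground: "X \<in> indeps M \<Longrightarrow> X \<subseteq> ground M"
  using M by (auto simp: is_matroid_def)

lemma indep_finite: "X \<in> indeps M \<Longrightarrow> finite X"
  using indep_ground finite_ground finite_subset by blast

lemma indep_mono: "Y \<in> indeps M \<Longrightarrow> X \<subseteq> Y \<Longrightarrow> X \<in> indeps M"
  using M unfolding is_matroid_def by blast

lemma indep_empty: "{} \<in> indeps M"
  using M by (simp add: is_matroid_def)

lemma indep_augment:
  "X \<in> indeps M \<Longrightarrow> Y \<in> indeps M \<Longrightarrow> card X < card Y \<Longrightarrow> \<exists>y \<in> Y - X. insert y X \<in> indeps M"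
  using M unfolding is_matroid_def by blast

text \<open>Iterated augmentation, by induction on the gap \<open>card Y - card X\<close>. Later
  arguments need both the exact final size and the fact that all added elements come from
  \<open>Y\<close>.\<close>

lemma indep_augment_card:
  assumes "X \<in> indeps M" "Y \<in> indeps M" "card X \<le> card Y"
  shows "\<exists>Z \<subseteq> Y - X. X \<union> Z \<in> indeps M \<and> card (X \<union> Z) = card Y"
  using assms
proof (induction "card Y - card X" arbitrary: X)
  case 0
  then show ?case by (intro exI[of _ "{}"]) auto
next
  case (Suc n)
  then obtain y where y: "y \<in> Y - X" "insert y X \<in> indeps M"
    using indep_augment[of X Y] by force
  have "card (insert y X) = Suc (card X)"
    using y indep_finite[OF Suc.prems(1)] by simp
  then have "n = card Y - card (insert y X)" "card (insert y X) \<le> card Y"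
    using Suc.hyps(2) by linarith+
  then obtain Z where Z: "Z \<subseteq> Y - insert y X" "insert y X \<union> Z \<in> indeps M"
      "card (insert y X \<union> Z) = card Y"
    using Suc.hyps(1)[OF _ y(2) Suc.prems(2)] by blast
  have "X \<union> insert y Z = insert y X \<union> Z" by blast
  then show ?case
    using y Z by (intro exI[of _ "insert y Z"]) auto
qed

text \<open>Subsets of independent sets are independent, so maximality need only be tested against
  extensions by a single element.\<close>

lemma basis_iff: "basis M B \<longleftrightarrow> B \<in> indeps M \<and> (\<forall>x \<in> ground M - B. insert x B \<notin> indeps M)"
proof
  assume "basis M B"
  then show "B \<in> indeps M \<and> (\<forall>x \<in> ground M - B. insert x B \<notin> indeps M)"
    unfolding basis_def by blast
next
  assume B: "B \<in> indeps M \<and> (\<forall>x \<in> ground M - B. insert x B \<notin> indeps M)"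
  have "X = B" if "X \<in> indeps M" "B \<subseteq> X" for X
  proof (rule ccontr)
    assume "X \<noteq> B"
    then obtain x where "x \<in> X - B" using \<open>B \<subseteq> X\<close> by blast
    then show False
      using B that indep_ground indep_mono[of X "insert x B"] by blast
  qed
  then show "basis M B"
    using B unfolding basis_def by blast
qed

lemma basis_indep: "basis M B \<Longrightarrow> B \<in> indeps M"
  by (simp add: basis_def)

lemma indep_card_le_basis:
  assumes "basis M B" "X \<in> indeps M"
  shows "card X \<le> card B"
  using assms indep_augment[of B X] indep_ground[of X] unfolding basis_iff by force

lemma indep_card_basis:
  assumes "basis M B" "X \<in> indeps M" "card X = card B"
  shows "basis M X"
proof -
  have "insert x X \<notin> indeps M" if "x \<in> ground M - X" for x
    using that indep_card_le_basis[OF assms(1), of "insert x X"] assms indep_finite by auto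
  then show ?thesis
    using assms by (auto simp: basis_iff)
qed

lemma basis_card_eq: "basis M B \<Longrightarrow> basis M B' \<Longrightarrow> card B = card B'"
  using indep_card_le_basis basis_indep by (meson le_antisym)

lemma ex_basis: "\<exists>B. basis M B"
proof -
  have "finite (indeps M)"
    using finite_ground indep_ground by (meson Pow_iff finite_Pow_iff finite_subset subsetI)
  then obtain B where "B \<in> indeps M" "\<forall>X \<in> indeps M. B \<subseteq> X \<longrightarrow> B = X"
    using finite_has_maximal[of "indeps M"] indep_empty by auto
  then show ?thesis
    unfolding basis_def by auto
qed

lemma indep_extend_basis:
  assumes X: "X \<in> indeps M"
  shows "\<exists>B. basis M B \<and> X \<subseteq> B"
proof -
  obtain B where B: "basis M B" using ex_basis by blast
  obtain Z where Z: "X \<union> Z \<in> indeps M" "card (X \<union> Z) = card B"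
    using indep_augment_card[OF X basis_indep[OF B] indep_card_le_basis[OF B X]] by blast
  then show ?thesis using indep_card_basis[OF B] by blast
qed

section \<open>Restrictions, contractions and minors\<close>

lemma is_matroid_restriction:
  assumes "A \<subseteq> ground M"
  shows "is_matroid (restriction M A)"
proof -
  let ?I = "{X \<in> indeps M. X \<subseteq> A}"
  have "\<exists>y \<in> Y - X. insert y X \<in> ?I" if "X \<in> ?I" "Y \<in> ?I" "card X < card Y" for X Y
    using indep_augment[of X Y] that by blast
  moreover have "X \<in> ?I" if "Y \<in> ?I" "X \<subseteq> Y" for X Y
    using that indep_mono by blast
  moreover have "finite A" "?I \<subseteq> Pow A" "{} \<in> ?I"
    using finite_subset[OF assms finite_ground] indep_empty by auto
  ultimately show ?thesis
    unfolding is_matroid_def restriction_def matroid.simps by blast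
qed

lemma restriction_ground: "restriction M (ground M) = M"
  using indep_ground by (cases M) (auto simp: restriction_def)

end

lemma basis_restriction_iff:
  assumes "is_matroid M" "A \<subseteq> ground M"
  shows "basis (restriction M A) J \<longleftrightarrow>
    J \<in> indeps M \<and> J \<subseteq> A \<and> (\<forall>x \<in> A - J. insert x J \<notin> indeps M)"
  unfolding basis_iff[OF is_matroid_restriction[OF assms]] by (auto simp: restriction_def)

lemma ground_minor [simp]: "ground (minor M G A) = G - A"
  by (simp add: minor_def contraction_def restriction_def)

context
  fixes M :: "'a matroid" and G A J :: "'a set"
  assumes M: "is_matroid M" and AG: "A \<subseteq> G" and GE: "G \<subseteq> ground M"
    and J: "basis (restriction M A) J"
begin

text \<open>The definition of contraction allows any basis of \<open>A\<close>; the fixed basis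
  \<open>J\<close> can always serve instead. Given a witness \<open>J'\<close>, augment
  \<open>J\<close> from \<open>X \<union> J'\<close>. No element of \<open>A\<close> can be added,
  since \<open>J\<close> is maximal in \<open>A\<close>, so everything added lies in
  \<open>X\<close>. As \<open>J\<close> and \<open>J'\<close> have the same size, counting shows
  that all of \<open>X\<close> is added.\<close>

lemma indep_minor_iff: "X \<in> indeps (minor M G A) \<longleftrightarrow> X \<subseteq> G - A \<and> X \<union> J \<in> indeps M"
proof -
  have AE: "A \<subseteq> ground M" using AG GE by blast
  note iff = basis_restriction_iff[OF M AE]
  have rr: "restriction (restriction M G) A = restriction M A"
    using AG by (auto simp: restriction_def)
  have indep: "X \<union> J \<in> indeps M"
    if X: "X \<subseteq> G - A" and J': "basis (restriction M A) J'" "X \<union> J' \<in> indeps M" for J'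
  proof -
    have card: "card J = card J'"
      using basis_card_eq[OF is_matroid_restriction[OF M AE]] J J' by blast
    have fin: "finite J" "finite X" "finite J'"
      using J J' iff indep_finite[OF M] by auto
    have JA: "J \<subseteq> A" "J' \<subseteq> A" using J J' iff by auto
    have cards: "card (X \<union> J') = card X + card J'"
      using X JA fin by (intro card_Un_disjoint) auto
    then obtain Z where Z: "Z \<subseteq> (X \<union> J') - J" "J \<union> Z \<in> indeps M" "card (J \<union> Z) = card (X \<union> J')"
      using indep_augment_card[OF M, of J "X \<union> J'"] J J' iff card by auto
    have "z \<notin> A" if "z \<in> Z" for z
      using that Z J iff indep_mono[OF M Z(2), of "insert z J"] by blast
    then have ZX: "Z \<subseteq> X" using Z JA by blast
    have "card (J \<union> Z) = card J + card Z"
      using ZX X JA fin finite_subset by (intro card_Un_disjoint) auto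
    then have "Z = X"
      using ZX fin Z cards card by (simp add: card_subset_eq)
    then show ?thesis using Z by (simp add: Un_commute)
  qed
  have "X \<in> indeps (contraction (restriction M G) A) \<longleftrightarrow> X \<subseteq> G - A \<and> X \<union> J \<in> indeps M"
    if "J \<subseteq> A"
  proof -
    have "(\<exists>J. basis (restriction M A) J \<and> X \<union> J \<in> indeps M \<and> X \<union> J \<subseteq> G) \<longleftrightarrow> X \<union> J \<in> indeps M"
      if "X \<subseteq> G - A"
      using that \<open>J \<subseteq> A\<close> J AG indep by blast
    then show ?thesis
      unfolding contraction_def rr by (simp add: restriction_def) blast
  qed
  then show ?thesis using J iff by (simp add: minor_def)
qed

lemma is_matroid_minor: "is_matroid (minor M G A)"
proof -
  have AE: "A \<subseteq> ground M" using AG GE by blast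
  have JA: "J \<subseteq> A" "J \<in> indeps M" "finite J"
    using J basis_restriction_iff[OF M AE] indep_finite[OF M] by auto
  have "\<exists>y \<in> Y - X. insert y X \<in> indeps (minor M G A)"
    if X: "X \<in> indeps (minor M G A)" and Y: "Y \<in> indeps (minor M G A)" and "card X < card Y" for X Y
  proof -
    have "card (X \<union> J) = card X + card J" "card (Y \<union> J) = card Y + card J"
      using X Y JA indep_minor_iff indep_finite[OF M, of "X \<union> J"] indep_finite[OF M, of "Y \<union> J"]
      by (auto intro!: card_Un_disjoint)
    then show ?thesis
      using indep_augment[OF M, of "X \<union> J" "Y \<union> J"] X Y that(3) by (auto simp: indep_minor_iff)
  qed
  moreover have "X \<in> indeps (minor M G A)" if "Y \<in> indeps (minor M G A)" "X \<subseteq> Y" for X Y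
    using that indep_mono[OF M, of "Y \<union> J" "X \<union> J"] by (auto simp: indep_minor_iff)
  moreover have "finite (G - A)"
    using finite_ground[OF M] GE finite_subset by blast
  moreover have "indeps (minor M G A) \<subseteq> Pow (G - A)" "{} \<in> indeps (minor M G A)"
    using JA by (auto simp: indep_minor_iff)
  ultimately show ?thesis
    unfolding is_matroid_def ground_minor by blast
qed

text \<open>Elements of \<open>A - J\<close> cannot extend \<open>J\<close>, let alone
  \<open>J \<union> X\<close>. Hence maximality of \<open>J \<union> X\<close> in \<open>G\<close>
  is tested on the elements of \<open>G - A\<close> only, which is maximality of \<open>X\<close> in
  the minor.\<close>

lemma basis_minor_iff:
  "basis (minor M G A) X \<longleftrightarrow> X \<subseteq> G - A \<and> basis (restriction M G) (J \<union> X)"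
proof -
  have AE: "A \<subseteq> ground M" using AG GE by blast
  have JA: "J \<subseteq> A" "\<And>x. x \<in> A - J \<Longrightarrow> insert x J \<notin> indeps M"
    using J basis_restriction_iff[OF M AE] by auto
  have max: "insert x (J \<union> X) \<notin> indeps M"
    if "X \<subseteq> G - A" "\<forall>x \<in> G - A - X. insert x (X \<union> J) \<notin> indeps M" "x \<in> G - (J \<union> X)" for x
    using that JA(2)[of x] indep_mono[OF M, of "insert x (J \<union> X)" "insert x J"]
    by (cases "x \<in> A") (auto simp: Un_commute)
  have "(X \<subseteq> G - A \<and> X \<union> J \<in> indeps M \<and>
        (\<forall>x \<in> G - A - X. \<not> (insert x X \<subseteq> G - A \<and> insert x X \<union> J \<in> indeps M))) \<longleftrightarrow>
      X \<subseteq> G - A \<and> J \<union> X \<in> indeps M \<and> J \<union> X \<subseteq> G \<and>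
        (\<forall>x \<in> G - (J \<union> X). insert x (J \<union> X) \<notin> indeps M)" (is "?l \<longleftrightarrow> ?r")
  proof (intro iffI)
    assume l: ?l
    then have "\<forall>x \<in> G - A - X. insert x (X \<union> J) \<notin> indeps M" by auto
    then show ?r
      using l JA(1) AG max by (simp add: Un_commute) blast
  next
    assume r: ?r
    then have "insert x X \<union> J \<notin> indeps M" if "x \<in> G - A - X" for x
      using that JA(1) by (auto simp: Un_commute)
    then show ?l using r by (simp add: Un_commute)
  qed
  then show ?thesis
    unfolding basis_iff[OF is_matroid_minor] basis_restriction_iff[OF M GE] indep_minor_iff
      ground_minor conj_assoc .
qed

end

section \<open>Fundamental circuits and cocircuits\<close>

text \<open>The edges of the fundamental graph, always written with the end in \<open>B\<close>
  first. Independence is enough for the exchanged set to be a basis, by cardinality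
  (\<open>exch_basis\<close>).\<close>

definition exch :: "'a matroid \<Rightarrow> 'a set \<Rightarrow> 'a \<Rightarrow> 'a \<Rightarrow> bool" where
  "exch M B b e \<longleftrightarrow> b \<in> B \<and> e \<in> ground M - B \<and> insert e (B - {b}) \<in> indeps M"

context
  fixes M :: "'a matroid" and B :: "'a set"
  assumes M: "is_matroid M" and B: "basis M B"
begin

lemma exch_basis:
  assumes "exch M B b e"
  shows "basis M (insert e (B - {b}))"
proof -
  have "finite B" using indep_finite[OF M basis_indep[OF M B]] .
  then have "card (insert e (B - {b})) = card B"
    using assms card_Suc_Diff1[of B b] by (simp add: exch_def)
  then show ?thesis
    using indep_card_basis[OF M B] assms by (simp add: exch_def)
qed

text \<open>Filling up \<open>insert e X\<close> from \<open>B\<close> to the size of a basis leaves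
  out exactly one element of \<open>B\<close>. That element is the neighbour of \<open>e\<close>
  outside \<open>X\<close>.\<close>

lemma augment_to_exch:
  assumes e: "e \<in> ground M - B" and X: "X \<subseteq> B" and ind: "insert e X \<in> indeps M"
  shows "\<exists>b \<in> B - X. exch M B b e"
proof -
  have fB: "finite B" using indep_finite[OF M basis_indep[OF M B]] .
  have le: "card (insert e X) \<le> card B" using indep_card_le_basis[OF M B ind] .
  obtain Z where Z: "Z \<subseteq> B - insert e X" "insert e X \<union> Z \<in> indeps M"
      "card (insert e X \<union> Z) = card B"
    using indep_augment_card[OF M ind basis_indep[OF M B] le] by blast
  let ?Y = "X \<union> Z"
  have Y: "?Y \<subseteq> B" "insert e X \<union> Z = insert e ?Y" using X Z by auto
  have "card (insert e ?Y) = Suc (card ?Y)"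
    using Y(1) fB e finite_subset by (subst card_insert_disjoint) auto
  then have c: "Suc (card ?Y) = card B" using Z Y by simp
  then have "card (B - ?Y) = 1"
    using Y(1) fB finite_subset by (subst card_Diff_subset) auto
  then obtain b where b: "B - ?Y = {b}" by (auto simp: card_1_singleton_iff)
  then have "?Y = B - {b}" using Y(1) by blast
  then show ?thesis
    using b Z Y e by (intro bexI[of _ b]) (auto simp: exch_def)
qed

text \<open>Were this set independent, \<open>augment_to_exch\<close> would produce a neighbour of
  \<open>e\<close> outside the set of all neighbours. A proper subset misses \<open>e\<close> or
  some neighbour \<open>b\<close>, so it lies in \<open>B\<close> or in the basis obtained by
  exchanging \<open>b\<close> for \<open>e\<close>.\<close>

lemma circuit_fund: "circuit M (insert e {b. exch M B b e})" if e: "e \<in> ground M - B"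
proof -
  let ?C = "insert e {b. exch M B b e}"
  have "?C \<notin> indeps M"
    using augment_to_exch[OF e, of "{b. exch M B b e}"] by (auto simp: exch_def)
  moreover have "X \<in> indeps M" if X: "X \<subset> ?C" for X
  proof (cases "e \<in> X")
    case True
    then obtain b where b: "exch M B b e" "b \<notin> X" using X by blast
    then have "X \<subseteq> insert e (B - {b})" using X by (auto simp: exch_def)
    then show ?thesis using b indep_mono[OF M] by (auto simp: exch_def)
  next
    case False
    then have "X \<subseteq> B" using X by (auto simp: exch_def)
    then show ?thesis using indep_mono[OF M basis_indep[OF M B]] by blast
  qed
  moreover have "?C \<subseteq> ground M"
    using e indep_ground[OF M basis_indep[OF M B]] by (auto simp: exch_def)
  ultimately show ?thesis by (simp add: circuit_def)
qed

text \<open>Uniqueness: a circuit inside \<open>B \<union> {e}\<close> that missed \<open>e\<close>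
  or a neighbour would lie in an independent set. So it contains the circuit of
  \<open>circuit_fund\<close>, and by minimality equals it.\<close>

lemma fund_circuit_eq: "fund_circuit M B e = insert e {b. exch M B b e}" if e: "e \<in> ground M - B"
  unfolding fund_circuit_def
proof (rule the_equality)
  show "circuit M (insert e {b. exch M B b e}) \<and> insert e {b. exch M B b e} \<subseteq> B \<union> {e}"
    using circuit_fund[OF e] by (simp, auto simp: exch_def)
next
  fix C assume C: "circuit M C \<and> C \<subseteq> B \<union> {e}"
  have "e \<in> C"
    using C indep_mono[OF M basis_indep[OF M B], of C] by (auto simp: circuit_def)
  moreover have "b \<in> C" if "exch M B b e" for b
  proof (rule ccontr)
    assume "b \<notin> C"
    then have "C \<subseteq> insert e (B - {b})" using C by auto
    then show False using C that indep_mono[OF M] by (auto simp: exch_def circuit_def)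
  qed
  ultimately have "insert e {b. exch M B b e} \<subseteq> C" by auto
  then show "C = insert e {b. exch M B b e}"
    using C circuit_fund[OF e] unfolding circuit_def by (metis psubsetI)
qed

text \<open>A subset of the ground set is dependent in the dual if it meets every basis. Augmenting
  \<open>B - {b}\<close> from an arbitrary basis adds \<open>b\<close> or a neighbour of
  \<open>b\<close>, so this set does meet every basis. A proper subset is avoided by
  \<open>B\<close> or by an exchanged basis.\<close>

lemma cocircuit_fund: "cocircuit M (insert b {e. exch M B b e})" if b: "b \<in> B"
proof -
  let ?D = "insert b {e. exch M B b e}"
  have DE: "?D \<subseteq> ground M"
    using b indep_ground[OF M basis_indep[OF M B]] by (auto simp: exch_def)
  have fB: "finite B" using indep_finite[OF M basis_indep[OF M B]] .
  have "?D \<inter> B' \<noteq> {}" if B': "basis M B'" for B'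
  proof -
    have "card (B - {b}) < card B'"
      using b fB basis_card_eq[OF M B B'] card_Diff1_less by metis
    then obtain e where e: "e \<in> B' - (B - {b})" "insert e (B - {b}) \<in> indeps M"
      using indep_augment[OF M indep_mono[OF M basis_indep[OF M B]] basis_indep[OF M B']] by blast
    moreover have "e \<in> ground M" using e indep_ground[OF M basis_indep[OF M B']] by blast
    ultimately have "e \<in> ?D" using b by (auto simp: exch_def)
    then show ?thesis using e by blast
  qed
  then have "?D \<notin> indeps (dual M)"
    by (auto simp: dual_def)
  moreover have "X \<in> indeps (dual M)" if X: "X \<subset> ?D" for X
  proof (cases "b \<in> X")
    case True
    then obtain e where e: "exch M B b e" "e \<notin> X" using X by blast
    then have "X \<inter> insert e (B - {b}) = {}" using X by (auto simp: exch_def)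
    then show ?thesis using exch_basis[OF e(1)] X DE by (auto simp: dual_def)
  next
    case False
    then have "X \<inter> B = {}" using X by (auto simp: exch_def)
    then show ?thesis using B X DE by (auto simp: dual_def)
  qed
  ultimately show ?thesis
    using DE unfolding cocircuit_def circuit_def by (simp add: dual_def)
qed

text \<open>Uniqueness: a cocircuit meets every basis. Testing with \<open>B\<close> puts
  \<open>b\<close> in it, and testing with the exchanged bases puts every neighbour of
  \<open>b\<close> in it.\<close>

lemma fund_cocircuit_eq: "fund_cocircuit M B b = insert b {e. exch M B b e}" if b: "b \<in> B"
  unfolding fund_cocircuit_def
proof (rule the_equality)
  show "cocircuit M (insert b {e. exch M B b e}) \<and> insert b {e. exch M B b e} \<subseteq> ground M - B \<union> {b}"
    using cocircuit_fund[OF b] by (simp, auto simp: exch_def)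
next
  fix D assume D: "cocircuit M D \<and> D \<subseteq> ground M - B \<union> {b}"
  have dep: "D \<inter> B' \<noteq> {}" if "basis M B'" for B'
    using that D by (auto simp: cocircuit_def circuit_def dual_def)
  have "b \<in> D" using dep[OF B] D by auto
  moreover have "e \<in> D" if "exch M B b e" for e
    using dep[OF exch_basis[OF that]] D by auto
  ultimately have "insert b {e. exch M B b e} \<subseteq> D" by auto
  then show "D = insert b {e. exch M B b e}"
    using D cocircuit_fund[OF b] unfolding circuit_def cocircuit_def by (metis psubsetI)
qed

end

section \<open>Activities read off the fundamental graph\<close>

lemma eq_Min_insert_iff:
  fixes x :: "'a::linorder"
  assumes "finite A" "x \<notin> A"
  shows "x = Min (insert x A) \<longleftrightarrow> (\<forall>y \<in> A. x < y)"
proof -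
  have "x = Min (insert x A) \<longleftrightarrow> (\<forall>y \<in> A. x \<le> y)"
    using assms(1) by (subst eq_Min_iff) auto
  then show ?thesis using assms(2) by (metis order.order_iff_strict)
qed

context
  fixes M :: "'a::linorder matroid" and B :: "'a set"
  assumes M: "is_matroid M" and B: "basis M B"
begin

lemma finite_exch: "finite {b. exch M B b e}" "finite {e. exch M B b e}"
proof -
  have "{b. exch M B b e} \<subseteq> B" "{e. exch M B b e} \<subseteq> ground M"
    by (auto simp: exch_def)
  then show "finite {b. exch M B b e}" "finite {e. exch M B b e}"
    using indep_finite[OF M basis_indep[OF M B]] finite_ground[OF M] finite_subset by blast+
qed

lemma int_set_eq: "int_set M B = {b \<in> B. \<forall>e. exch M B b e \<longrightarrow> b < e}"
proof -
  have "b = Min (fund_cocircuit M B b) \<longleftrightarrow> (\<forall>e. exch M B b e \<longrightarrow> b < e)" if "b \<in> B" for b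
    unfolding fund_cocircuit_eq[OF M B that]
    by (subst eq_Min_insert_iff[OF finite_exch(2)]) (use that in \<open>auto simp: exch_def\<close>)
  then show ?thesis unfolding int_set_def by blast
qed

lemma ext_set_eq: "ext_set M B = {e \<in> ground M - B. \<forall>b. exch M B b e \<longrightarrow> e < b}"
proof -
  have "e = Min (fund_circuit M B e) \<longleftrightarrow> (\<forall>b. exch M B b e \<longrightarrow> e < b)"
    if "e \<in> ground M - B" for e
    unfolding fund_circuit_eq[OF M B that]
    by (subst eq_Min_insert_iff[OF finite_exch(1)]) (use that in \<open>auto simp: exch_def\<close>)
  then show ?thesis unfolding ext_set_def by blast
qed

end

section \<open>Restrictions and minors in the fundamental graph\<close>

text \<open>An edge from \<open>e\<close> in \<open>A\<close> to \<open>b\<close> outside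
  \<open>A\<close> lets \<open>e\<close> be added to \<open>B \<inter> A\<close>. Conversely, if
  some \<open>e\<close> in \<open>A\<close> can be added, \<open>augment_to_exch\<close> yields such
  an edge. This is how monotonicity of labels becomes a statement about bases.\<close>

lemma basis_restriction_Int_iff:
  assumes M: "is_matroid M" and B: "basis M B" and AE: "A \<subseteq> ground M"
  shows "basis (restriction M A) (B \<inter> A) \<longleftrightarrow> (\<forall>b e. exch M B b e \<and> e \<in> A \<longrightarrow> b \<in> A)"
    (is "?l \<longleftrightarrow> ?r")
proof
  assume l: ?l
  show ?r
  proof (intro allI impI, rule ccontr)
    fix b e assume be: "exch M B b e \<and> e \<in> A" and "b \<notin> A"
    then have "insert e (B \<inter> A) \<subseteq> insert e (B - {b})" by auto
    then have "insert e (B \<inter> A) \<in> indeps M"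
      using be indep_mono[OF M] by (auto simp: exch_def)
    then show False
      using l be basis_restriction_iff[OF M AE] by (auto simp: exch_def)
  qed
next
  assume r: ?r
  have "insert e (B \<inter> A) \<notin> indeps M" if e: "e \<in> A - (B \<inter> A)" for e
  proof
    assume "insert e (B \<inter> A) \<in> indeps M"
    then obtain b where "b \<in> B - B \<inter> A" "exch M B b e"
      using augment_to_exch[OF M B, of e "B \<inter> A"] e AE by auto
    then show False using r e by auto
  qed
  then show ?l
    using indep_mono[OF M basis_indep[OF M B], of "B \<inter> A"]
    by (auto simp: basis_restriction_iff[OF M AE])
qed

text \<open>Independence in the minor is tested after adding back \<open>B \<inter> A\<close>. The
  exchange thus lives in \<open>G\<close>, where it has to be compared with an exchange in all of
  \<open>B\<close>.\<close>

lemma exch_minor_iff: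
  assumes M: "is_matroid M" and B: "basis M B" and AG: "A \<subseteq> G" and GE: "G \<subseteq> ground M"
    and BA: "basis (restriction M A) (B \<inter> A)" and BG: "basis (restriction M G) (B \<inter> G)"
  shows "exch (minor M G A) (B \<inter> (G - A)) b e \<longleftrightarrow> exch M B b e \<and> b \<in> G - A \<and> e \<in> G - A"
proof
  assume l: "exch (minor M G A) (B \<inter> (G - A)) b e"
  have "insert e (B \<inter> (G - A) - {b}) \<union> (B \<inter> A) = insert e (B \<inter> G - {b})"
    using l AG by (auto simp: exch_def)
  then have ind: "insert e (B \<inter> G - {b}) \<in> indeps M" and e: "e \<in> ground M - B" "e \<in> G - A"
    and b: "b \<in> B" "b \<in> G - A"
    using l GE unfolding exch_def indep_minor_iff[OF M AG GE BA] by auto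
  \<comment> \<open>Some neighbour of \<open>e\<close> avoids \<open>B \<inter> G - {b}\<close>.
    Edges from elements of \<open>G\<close> outside \<open>B\<close> do not leave \<open>G\<close>,
    so this neighbour is \<open>b\<close>.\<close>
  obtain b' where "b' \<in> B - (B \<inter> G - {b})" "exch M B b' e"
    using augment_to_exch[OF M B e(1) _ ind] by blast
  moreover have "b' \<in> G"
    using BG basis_restriction_Int_iff[OF M B GE] calculation(2) e(2) by blast
  ultimately show "exch M B b e \<and> b \<in> G - A \<and> e \<in> G - A" using e b by auto
next
  assume r: "exch M B b e \<and> b \<in> G - A \<and> e \<in> G - A"
  then have "insert e (B \<inter> (G - A) - {b}) \<union> (B \<inter> A) \<subseteq> insert e (B - {b})" by auto
  then have "insert e (B \<inter> (G - A) - {b}) \<union> (B \<inter> A) \<in> indeps M"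
    using r indep_mono[OF M] unfolding exch_def by blast
  then show "exch (minor M G A) (B \<inter> (G - A)) b e"
    using r unfolding exch_def indep_minor_iff[OF M AG GE BA] by auto
qed

section \<open>Connectedness\<close>

context
  fixes M :: "'a matroid"
  assumes M: "is_matroid M"
begin

lemma dependent_contains_circuit:
  assumes "X \<subseteq> ground M" "X \<notin> indeps M"
  shows "\<exists>C \<subseteq> X. circuit M C"
proof -
  have "finite X" using assms(1) finite_ground[OF M] finite_subset by blast
  then show ?thesis using assms
  proof (induction X rule: finite_psubset_induct)
    case (psubset X)
    show ?case
    proof (cases "\<exists>Y. Y \<subset> X \<and> Y \<notin> indeps M")
      case True
      then obtain Y where Y: "Y \<subset> X" "Y \<notin> indeps M" by blast
      then obtain C where "C \<subseteq> Y" "circuit M C"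
        using psubset.IH[of Y] psubset.prems(1) by (meson order.trans psubset_imp_subset)
      then show ?thesis using Y by blast
    next
      case False
      then show ?thesis using psubset.prems by (auto simp: circuit_def)
    qed
  qed
qed

text \<open>Inside \<open>C1 \<union> C2 - {e}\<close>, extend \<open>C2 - {x}\<close> to a basis
  \<open>J\<close>, which then misses \<open>x\<close>. The set \<open>insert e J\<close> turns out
  to be dependent, and any circuit in it contains \<open>e\<close> and avoids
  \<open>x\<close>.\<close>

lemma strong_circuit_elimination:
  assumes C1: "circuit M C1" and C2: "circuit M C2" and x: "x \<in> C1 \<inter> C2" and e: "e \<in> C1 - C2"
  shows "\<exists>C. circuit M C \<and> e \<in> C \<and> C \<subseteq> C1 \<union> C2 - {x}"
proof -
  let ?U = "C1 \<union> C2 - {e}"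
  have UE: "?U \<subseteq> ground M" using C1 C2 by (auto simp: circuit_def)
  note mU = is_matroid_restriction[OF M UE]
  have "C2 - {x} \<in> indeps (restriction M ?U)" "C1 - {e} \<in> indeps (restriction M ?U)"
  proof -
    have "C2 - {x} \<subset> C2" "C1 - {e} \<subset> C1" using x e by auto
    then have "C2 - {x} \<in> indeps M" "C1 - {e} \<in> indeps M"
      using C1 C2 by (simp_all add: circuit_def)
    then show "C2 - {x} \<in> indeps (restriction M ?U)" "C1 - {e} \<in> indeps (restriction M ?U)"
      using e by (auto simp: restriction_def)
  qed
  from indep_extend_basis[OF mU this(1)] indep_extend_basis[OF mU this(2)]
  obtain J J1 where J: "basis (restriction M ?U) J" "C2 - {x} \<subseteq> J"
    and J1: "basis (restriction M ?U) J1" "C1 - {e} \<subseteq> J1"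
    by blast
  note Ji = J(1)[unfolded basis_restriction_iff[OF M UE]]
  note J1i = J1(1)[unfolded basis_restriction_iff[OF M UE]]
  have xJ: "x \<notin> J"
  proof
    assume "x \<in> J"
    then have "C2 \<subseteq> J" using J by auto
    then show False using Ji C2 indep_mono[OF M] by (auto simp: circuit_def)
  qed
  \<comment> \<open>Otherwise \<open>J1\<close>, which has the size of \<open>J\<close>, could be
    augmented from \<open>insert e J\<close>. Adding \<open>e\<close> would complete the circuit
    \<open>C1\<close>; adding anything else contradicts the maximality of \<open>J1\<close>.\<close>
  have "insert e J \<notin> indeps M"
  proof
    assume i: "insert e J \<in> indeps M"
    have "card J = card J1" using basis_card_eq[OF mU J(1) J1(1)] .
    moreover have "card (insert e J) = Suc (card J)"
      using Ji indep_finite[OF M] by (subst card_insert_disjoint) auto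
    ultimately obtain y where y: "y \<in> insert e J - J1" "insert y J1 \<in> indeps M"
      using indep_augment[OF M _ i, of J1] J1i by auto
    show False
    proof (cases "y = e")
      case True
      then have "C1 \<subseteq> insert y J1" using J1 by auto
      then show ?thesis using y C1 indep_mono[OF M] by (auto simp: circuit_def)
    next
      case False
      then show ?thesis using y Ji J1i by blast
    qed
  qed
  moreover have "insert e J \<subseteq> ground M" using Ji UE C1 e by (auto simp: circuit_def)
  ultimately obtain C where C: "C \<subseteq> insert e J" "circuit M C"
    using dependent_contains_circuit by blast
  have "e \<in> C"
  proof (rule ccontr)
    assume "e \<notin> C"
    then have "C \<subseteq> J" using C by auto
    then show False using Ji C(2) indep_mono[OF M] by (auto simp: circuit_def)
  qed
  then show ?thesis using C xJ Ji x e by (intro exI[of _ C]) auto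
qed

lemma circuit_not_psubset: "circuit M C \<Longrightarrow> circuit M C' \<Longrightarrow> \<not> C \<subset> C'"
  by (auto simp: circuit_def)

lemma circuit_finite: "circuit M C \<Longrightarrow> finite C"
  using finite_ground[OF M] finite_subset by (auto simp: circuit_def)

text \<open>Induction on the size of the union. Eliminating a common element \<open>x\<close> gives
  \<open>C3\<close> through \<open>e\<close> and \<open>C4\<close> through \<open>f\<close>. If
  neither settles the claim, one of the pairs \<open>C3\<close>, \<open>C2\<close> and
  \<open>C1\<close>, \<open>C4\<close> has a smaller union, or else the pair \<open>C3\<close>,
  \<open>C4\<close> does, since both avoid \<open>x\<close>.\<close>

lemma circuit_join:
  assumes "circuit M C1" "circuit M C2" "C1 \<inter> C2 \<noteq> {}" "e \<in> C1 - C2" "f \<in> C2 - C1"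
  shows "\<exists>C. circuit M C \<and> e \<in> C \<and> f \<in> C"
  using assms
proof (induction "card (C1 \<union> C2)" arbitrary: C1 C2 rule: less_induct)
  case less
  have fin: "finite (C1 \<union> C2)" using less.prems circuit_finite by blast
  obtain x where x: "x \<in> C1 \<inter> C2" using less.prems by blast
  obtain C3 where C3: "circuit M C3" "e \<in> C3" "C3 \<subseteq> C1 \<union> C2 - {x}"
    using strong_circuit_elimination[OF less.prems(1,2) x less.prems(4)] by blast
  obtain C4 where C4: "circuit M C4" "f \<in> C4" "C4 \<subseteq> C1 \<union> C2 - {x}"
    using strong_circuit_elimination[OF less.prems(2,1) _ less.prems(5)] x by (metis Int_commute Un_commute)
  \<comment> \<open>\<open>C3\<close> avoids \<open>x\<close>, so it would be a proper subset of
    \<open>C1\<close> if it did not reach into \<open>C2 - C1\<close>; circuits are never nested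
    properly.\<close>
  have m3: "C3 \<inter> (C2 - C1) \<noteq> {}"
    using circuit_not_psubset[OF C3(1) less.prems(1)] C3 x by blast
  have m4: "C4 \<inter> (C1 - C2) \<noteq> {}"
    using circuit_not_psubset[OF C4(1) less.prems(2)] C4 x by blast
  consider "f \<in> C3" | "e \<in> C4" | "f \<notin> C3" "e \<notin> C4" "C3 \<union> C2 \<subset> C1 \<union> C2"
    | "f \<notin> C3" "e \<notin> C4" "C1 \<union> C4 \<subset> C1 \<union> C2"
    | "f \<notin> C3" "e \<notin> C4" "C3 \<union> C2 = C1 \<union> C2" "C1 \<union> C4 = C1 \<union> C2"
    using C3 C4 by blast
  then show ?case
  proof cases
    case 1
    then show ?thesis using C3 by blast
  next
    case 2
    then show ?thesis using C4 by blast
  next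
    case 3
    then have "card (C3 \<union> C2) < card (C1 \<union> C2)" using psubset_card_mono[OF fin] by blast
    then show ?thesis
      using less.hyps[OF _ C3(1) less.prems(2)] 3 m3 C3 less.prems by blast
  next
    case 4
    then have "card (C1 \<union> C4) < card (C1 \<union> C2)" using psubset_card_mono[OF fin] by blast
    then show ?thesis
      using less.hyps[OF _ less.prems(1) C4(1)] 4 m4 C4 less.prems by blast
  next
    case 5
    have "C3 \<union> C4 \<subset> C1 \<union> C2" using C3 C4 x by blast
    then have "card (C3 \<union> C4) < card (C1 \<union> C2)" using psubset_card_mono[OF fin] by blast
    \<comment> \<open>Equality of the unions puts all of \<open>C2 - C1\<close> into
      \<open>C4\<close>, and by \<open>m3\<close> the circuit \<open>C3\<close> meets that
      difference.\<close>
    moreover have "C3 \<inter> C4 \<noteq> {}" using 5 m3 by blast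
    ultimately show ?thesis
      using less.hyps[OF _ C3(1) C4(1)] 5 C3 C4 by blast
  qed
qed

lemma circuit_trans:
  assumes "circuit M C1" "e \<in> C1" "f \<in> C1" "circuit M C2" "f \<in> C2" "g \<in> C2"
  shows "\<exists>C. circuit M C \<and> e \<in> C \<and> g \<in> C"
  using circuit_join[of C1 C2 e g] assms by blast

end

text \<open>Descending along edges from any element must end at \<open>m\<close>, because the ground
  set is finite. Adjacent elements share a fundamental circuit, and lying on a common circuit is
  transitive by \<open>circuit_trans\<close>.\<close>

lemma connected_matroid_if_descent:
  fixes M :: "'a::linorder matroid"
  assumes M: "is_matroid M" and B: "basis M B"
    and desc: "\<And>x. x \<in> ground M \<Longrightarrow> x \<noteq> m \<Longrightarrow>
      \<exists>y \<in> ground M. y < x \<and> (exch M B x y \<or> exch M B y x)"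
  shows "connected_matroid M"
proof -
  define r where "r x y \<longleftrightarrow> x = y \<or> (\<exists>C. circuit M C \<and> x \<in> C \<and> y \<in> C)" for x y
  have sym: "r x y \<Longrightarrow> r y x" for x y
    by (auto simp: r_def)
  have trans: "r x y \<Longrightarrow> r y z \<Longrightarrow> r x z" for x y z
    using circuit_trans[OF M] unfolding r_def by metis
  have edge: "r x y" if "exch M B x y" for x y
  proof -
    have "y \<in> ground M - B" using that by (simp add: exch_def)
    then have "circuit M (insert y {b. exch M B b y})" by (rule circuit_fund[OF M B])
    then show ?thesis unfolding r_def using that by blast
  qed
  have root: "r x m" if "x \<in> ground M" for x
    using that
  proof (induction "card {y \<in> ground M. y < x}" arbitrary: x rule: less_induct)
    case less
    show ?case
    proof (cases "x = m")
      case True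
      then show ?thesis by (simp add: r_def)
    next
      case False
      then obtain y where y: "y \<in> ground M" "y < x" "exch M B x y \<or> exch M B y x"
        using desc less.prems by blast
      have "{z \<in> ground M. z < y} \<subset> {z \<in> ground M. z < x}" using y by auto
      then have "card {z \<in> ground M. z < y} < card {z \<in> ground M. z < x}"
        using finite_ground[OF M] by (intro psubset_card_mono) auto
      then have "r y m" using less.hyps y by blast
      then show ?thesis using trans edge sym y(3) by blast
    qed
  qed
  have "r x y" if "x \<in> ground M" "y \<in> ground M" for x y
    using trans[OF root[OF that(1)] sym[OF root[OF that(2)]]] .
  then show ?thesis unfolding connected_matroid_def r_def by blast
qed

section \<open>Labellings of the fundamental graph\<close>

text \<open>A common form of the two active closures: \<open>S\<close> is \<open>B\<close> with the
  edges as they are for the internal one, and the complement of \<open>B\<close> with the edges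
  reversed for the external one.\<close>

definition graph_acl :: "'a::linorder set \<Rightarrow> 'a set \<Rightarrow> ('a \<Rightarrow> 'a \<Rightarrow> bool) \<Rightarrow> 'a set \<Rightarrow> 'a set" where
  "graph_acl E S R X = (LEAST A. A \<subseteq> E \<and> X \<subseteq> A \<and> (\<forall>b \<in> S \<inter> A. {e. R b e} \<subseteq> A) \<and>
     (\<forall>b \<in> S. {e. R b e \<and> e < b} \<noteq> {} \<and> {e. R b e \<and> e < b} \<subseteq> A \<longrightarrow> b \<in> A))"

text \<open>
  The elements with label $j$ form $F_j \setminus F_{j-1}$ if $j \ge 1$ and
  $F'_{-j} \setminus F'_{1-j}$ if $j \le 0$, and \<open>m j\<close> is the least of them. This shift makes
  \<open>1 - lam\<close> the labelling of the dual.
\<close>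

locale active_labelling =
  fixes E B :: "'a::linorder set" and R :: "'a \<Rightarrow> 'a \<Rightarrow> bool"
    and lam :: "'a \<Rightarrow> int" and m :: "int \<Rightarrow> 'a" and \<epsilon> \<iota> :: nat
  assumes fin: "finite E"
    and B_sub: "B \<subseteq> E"
    and R_dom: "\<And>b e. R b e \<Longrightarrow> b \<in> B \<and> e \<in> E - B"
    and lam_mono: "\<And>b e. R b e \<Longrightarrow> lam b \<le> lam e"
    and lam_range: "\<And>x. x \<in> E \<Longrightarrow> lam x \<in> {1 - int \<epsilon>..int \<iota>}"
    and m_in: "\<And>j. j \<in> {1 - int \<epsilon>..int \<iota>} \<Longrightarrow> m j \<in> E"
    and lam_m: "\<And>j. j \<in> {1 - int \<epsilon>..int \<iota>} \<Longrightarrow> lam (m j) = j"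
    and m_least: "\<And>x. x \<in> E \<Longrightarrow> m (lam x) \<le> x"
    and m_int: "\<And>j. j \<in> {1..int \<iota>} \<Longrightarrow> m j \<in> B"
    and m_ext: "\<And>j. j \<in> {1 - int \<epsilon>..0} \<Longrightarrow> m j \<notin> B"
    and m_inc: "\<And>i j. 1 \<le> i \<Longrightarrow> i < j \<Longrightarrow> j \<le> int \<iota> \<Longrightarrow> m i < m j"
    and m_dec: "\<And>i j. 1 - int \<epsilon> \<le> i \<Longrightarrow> i < j \<Longrightarrow> j \<le> 0 \<Longrightarrow> m j < m i"
    and desc: "\<And>x. x \<in> E \<Longrightarrow> x \<noteq> m (lam x) \<Longrightarrow> \<exists>y < x. lam y = lam x \<and> (R x y \<or> R y x)"
begin

text \<open>Complementing \<open>B\<close> reverses the edges, and the reflection of labels at 1/2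
  exchanges positive with nonpositive ones. Every result below on internal activity thus has its
  external counterpart for free.\<close>

lemma dual_labelling:
  "active_labelling E (E - B) (\<lambda>x y. R y x) (\<lambda>x. 1 - lam x) (\<lambda>j. m (1 - j)) \<iota> \<epsilon>"
proof
  show "finite E" "E - B \<subseteq> E" using fin by auto
  show "e \<in> E - B \<and> b \<in> E - (E - B)" if "R b e" for b e
    using R_dom[OF that] B_sub by auto
  show "1 - lam e \<le> 1 - lam b" if "R b e" for b e
    using lam_mono[OF that] by simp
  show "1 - lam x \<in> {1 - int \<iota>..int \<epsilon>}" if "x \<in> E" for x
    using lam_range[OF that] by auto
  show "m (1 - j) \<in> E" "1 - lam (m (1 - j)) = j" if "j \<in> {1 - int \<iota>..int \<epsilon>}" for j
    using m_in[of "1 - j"] lam_m[of "1 - j"] that by auto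
  show "m (1 - (1 - lam x)) \<le> x" if "x \<in> E" for x
    using m_least[OF that] by simp
  show "m (1 - j) \<in> E - B" if "j \<in> {1..int \<epsilon>}" for j
    using m_in[of "1 - j"] m_ext[of "1 - j"] that by auto
  show "m (1 - j) \<notin> E - B" if "j \<in> {1 - int \<iota>..0}" for j
    using m_int[of "1 - j"] that by auto
  show "m (1 - i) < m (1 - j)" if "1 \<le> i" "i < j" "j \<le> int \<epsilon>" for i j
    using m_dec[of "1 - j" "1 - i"] that by auto
  show "m (1 - j) < m (1 - i)" if "1 - int \<iota> \<le> i" "i < j" "j \<le> 0" for i j
    using m_inc[of "1 - j" "1 - i"] that by auto
  show "\<exists>y < x. 1 - lam y = 1 - lam x \<and> (R y x \<or> R x y)"
    if "x \<in> E" "x \<noteq> m (1 - (1 - lam x))" for x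
    using desc[OF that(1)] that(2) by auto
qed

text \<open>By \<open>desc\<close> only the least element of a label can be active, and by
  \<open>m_ext\<close> its label is positive if it lies in \<open>B\<close>. Conversely, along an
  edge from \<open>m j\<close> to \<open>e\<close> the label does not drop. As \<open>m\<close>
  increases on positive labels, \<open>m j\<close> is at most \<open>m (lam e)\<close>, hence at
  most \<open>e\<close>.\<close>

lemma internally_active: "{b \<in> B. \<forall>e. R b e \<longrightarrow> b < e} = m ` {1..int \<iota>}"
proof (intro equalityI subsetI)
  fix b assume b: "b \<in> {b \<in> B. \<forall>e. R b e \<longrightarrow> b < e}"
  then have bE: "b \<in> E" using B_sub by auto
  have eq: "b = m (lam b)"
  proof (rule ccontr)
    assume "b \<noteq> m (lam b)"
    then obtain y where "y < b" "R b y \<or> R y b" using desc[OF bE] by blast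
    then show False using b R_dom by fastforce
  qed
  then have "lam b \<notin> {1 - int \<epsilon>..0}" using m_ext b by fastforce
  then have "lam b \<in> {1..int \<iota>}" using lam_range[OF bE] by auto
  then show "b \<in> m ` {1..int \<iota>}" using eq by blast
next
  fix b assume "b \<in> m ` {1..int \<iota>}"
  then obtain j where j: "j \<in> {1..int \<iota>}" "b = m j" by blast
  have "b < e" if R: "R b e" for e
  proof -
    have e: "e \<in> E" "e \<notin> B" using R_dom[OF R] by auto
    have "j \<le> lam e" using lam_mono[OF R] lam_m[of j] j by auto
    then have "m j \<le> m (lam e)"
      using m_inc[of j "lam e"] j lam_range[OF e(1)] by (cases "j = lam e") auto
    then have "b \<le> e" using m_least[OF e(1)] j by auto
    then show ?thesis using R_dom[OF R] by (metis DiffD2 order.not_eq_order_implies_strict)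
  qed
  then show "b \<in> {b \<in> B. \<forall>e. R b e \<longrightarrow> b < e}" using j m_int by auto
qed

text \<open>The elements with label above \<open>k\<close> are closed: labels do not drop along
  edges leaving \<open>B\<close>, and an inactive element of \<open>B\<close> has a smaller
  neighbour of its own label. They lie in every closed set containing the generators, by induction
  along the order.\<close>

lemma graph_acl_internal:
  assumes k: "0 \<le> k"
  shows "graph_acl E B R (m ` {k + 1..int \<iota>}) = {x \<in> E. k < lam x}"
  unfolding graph_acl_def
proof (rule Least_equality, intro conjI ballI impI)
  show "{x \<in> E. k < lam x} \<subseteq> E" by auto
  show "m ` {k + 1..int \<iota>} \<subseteq> {x \<in> E. k < lam x}"
    using m_in lam_m k by auto
  show "{e. R b e} \<subseteq> {x \<in> E. k < lam x}" if "b \<in> B \<inter> {x \<in> E. k < lam x}" for b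
  proof
    fix e assume "e \<in> {e. R b e}"
    then show "e \<in> {x \<in> E. k < lam x}"
      using that R_dom[of b e] lam_mono[of b e] by auto
  qed
  show "b \<in> {x \<in> E. k < lam x}"
    if b: "b \<in> B" and N: "{e. R b e \<and> e < b} \<noteq> {} \<and> {e. R b e \<and> e < b} \<subseteq> {x \<in> E. k < lam x}"
    for b
  proof -
    have bE: "b \<in> E" using b B_sub by auto
    \<comment> \<open>The set of smaller neighbours is nonempty, so \<open>b\<close> is not
      internally active, whereas an \<open>m j\<close> in \<open>B\<close> would be.\<close>
    have "b \<noteq> m (lam b)"
    proof
      assume eq: "b = m (lam b)"
      then have "lam b \<notin> {1 - int \<epsilon>..0}" using m_ext[of "lam b"] b by auto
      then have "lam b \<in> {1..int \<iota>}" using lam_range[OF bE] by auto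
      then have "b \<in> {b \<in> B. \<forall>e. R b e \<longrightarrow> b < e}"
        unfolding internally_active using eq by blast
      then show False using N by fastforce
    qed
    then obtain y where y: "y < b" "lam y = lam b" "R b y \<or> R y b" using desc[OF bE] by blast
    then have "R b y" using R_dom b by blast
    then show ?thesis using y N bE by auto
  qed
next
  fix A
  assume A: "A \<subseteq> E \<and> m ` {k + 1..int \<iota>} \<subseteq> A \<and> (\<forall>b \<in> B \<inter> A. {e. R b e} \<subseteq> A) \<and>
     (\<forall>b \<in> B. {e. R b e \<and> e < b} \<noteq> {} \<and> {e. R b e \<and> e < b} \<subseteq> A \<longrightarrow> b \<in> A)"
  have "x \<in> A" if "x \<in> E" "k < lam x" for x
    using that
  proof (induction "card {y \<in> E. y < x}" arbitrary: x rule: less_induct)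
    case less
    have IH: "y \<in> A" if "y \<in> E" "y < x" "k < lam y" for y
    proof -
      have "{z \<in> E. z < y} \<subset> {z \<in> E. z < x}" using that by auto
      then have "card {z \<in> E. z < y} < card {z \<in> E. z < x}"
        using fin by (intro psubset_card_mono) auto
      then show ?thesis using less.hyps that by blast
    qed
    show ?case
    proof (cases "x = m (lam x)")
      case True
      then show ?thesis using A lam_range[OF less.prems(1)] less.prems(2) by fastforce
    next
      case False
      then obtain y where y: "y < x" "lam y = lam x" "R x y \<or> R y x"
        using desc[OF less.prems(1)] by blast
      have yE: "y \<in> E" using y R_dom B_sub by blast
      have yA: "y \<in> A" using IH[OF yE y(1)] y less.prems by simp
      show ?thesis
      \<comment> \<open>For \<open>x\<close> in \<open>B\<close> all smaller neighbours have labels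
        above \<open>k\<close> and lie in \<open>A\<close> by induction, so the second closure rule
        applies, with \<open>y\<close> as witness of nonemptiness. For \<open>x\<close> outside
        \<open>B\<close>, the neighbour \<open>y\<close> is in \<open>B \<inter> A\<close> and the
        first rule brings in \<open>x\<close>.\<close>
      proof (cases "x \<in> B")
        case True
        then have "R x y" using y R_dom by blast
        then have "{e. R x e \<and> e < x} \<noteq> {}" using y by blast
        moreover have "{e. R x e \<and> e < x} \<subseteq> A"
          using IH R_dom lam_mono less.prems by fastforce
        ultimately show ?thesis using A True by blast
      next
        case False
        then have "R y x" using y R_dom by blast
        then show ?thesis using A yA R_dom by blast
      qed
    qed
  qed
  then show "{x \<in> E. k < lam x} \<subseteq> A" by auto
qed

lemma sorted_list_internal:
  "sorted_list_of_set (m ` {1..int \<iota>}) = map (\<lambda>k. m (int k)) [1..<\<iota> + 1]"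
proof -
  let ?xs = "map (\<lambda>k. m (int k)) [1..<\<iota> + 1]"
  have "sorted_wrt (\<lambda>i j. m (int i) < m (int j)) [1..<\<iota> + 1]"
    by (rule sorted_wrt_mono_rel[OF _ sorted_wrt_upt]) (auto intro: m_inc)
  then have "sorted_wrt (<) ?xs" by (simp only: sorted_wrt_map)
  then have "sorted ?xs" "distinct ?xs" using strict_sorted_iff by blast+
  then have "sorted_list_of_set (set ?xs) = ?xs"
    by (rule sorted_list_of_set.idem_if_sorted_distinct)
  moreover have "{1..int \<iota>} = int ` {1..<\<iota> + 1}"
    using image_int_atLeastAtMost[of 1 \<iota>] by (simp add: atLeastLessThanSuc_atLeastAtMost)
  then have "m ` {1..int \<iota>} = set ?xs" by (simp only: set_map set_upt image_image)
  ultimately show ?thesis by simp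
qed

end

section \<open>Existence of the labelling\<close>

text \<open>Recursion along the order, where the value at \<open>x\<close> may depend on the set of
  values at smaller elements related to \<open>x\<close>. Elements are added in increasing order, so
  a new one never disturbs earlier values.\<close>

lemma finite_linorder_recursion:
  fixes A :: "'a::linorder set" and G :: "'a \<Rightarrow> 'b set \<Rightarrow> 'b"
  assumes "finite A"
  shows "\<exists>f. \<forall>x \<in> A. f x = G x (f ` {y \<in> A. y < x \<and> P x y})"
  using assms
proof (induction A rule: finite_linorder_max_induct)
  case empty
  then show ?case by simp
next
  case (insert b A)
  then obtain f where f: "f x = G x (f ` {y \<in> A. y < x \<and> P x y})" if "x \<in> A" for x by blast
  let ?f = "f(b := G b (f ` {y \<in> A. y < b \<and> P b y}))"
  have "{y \<in> insert b A. y < x \<and> P x y} = {y \<in> A. y < x \<and> P x y}" if "x \<in> insert b A" for x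
    using insert.hyps that by auto
  moreover have "?f ` {y \<in> A. y < x \<and> P x y} = f ` {y \<in> A. y < x \<and> P x y}" for x
    using insert.hyps by (intro image_cong) auto
  ultimately have "?f x = G x (?f ` {y \<in> insert b A. y < x \<and> P x y})" if "x \<in> insert b A" for x
    using f[of x] that insert.hyps by (cases "x = b") auto
  then show ?case by blast
qed

lemma ex_strict_mono_enumeration:
  fixes A :: "'a::linorder set"
  assumes "finite A"
  shows "\<exists>h. bij_betw h {..<card A} A \<and> strict_mono_on {..<card A} h"
proof -
  let ?xs = "sorted_list_of_set A"
  have "bij_betw ((!) ?xs) {..<card A} A"
    using assms by (intro bij_betw_nth) auto
  moreover have "strict_mono_on {..<card A} ((!) ?xs)"
    using sorted_wrt_nth_less[OF strict_sorted_list_of_set[of A]]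
    by (auto intro!: strict_mono_onI)
  ultimately show ?thesis by blast
qed

text \<open>The labels are built by recursion from the active elements upwards. Each inactive
  element copies the label of some smaller neighbour; this gives \<open>desc\<close>, and following
  it down gives the range and \<open>m_least\<close>.\<close>

lemma ex_active_labelling:
  fixes E B :: "'a::linorder set"
  assumes fin: "finite E" and BE: "B \<subseteq> E" and dom: "\<And>b e. R b e \<Longrightarrow> b \<in> B \<and> e \<in> E - B"
  shows "\<exists>lam m \<epsilon> \<iota>. active_labelling E B R lam m \<epsilon> \<iota>"
proof -
  define I where "I = {b \<in> B. \<forall>e. R b e \<longrightarrow> b < e}"
  define X where "X = {e \<in> E - B. \<forall>b. R b e \<longrightarrow> e < b}"
  have finI: "finite I" and finX: "finite X"
    using finite_subset[OF _ fin, of I] finite_subset[OF _ fin, of X] BE by (auto simp: I_def X_def)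
  obtain h where h: "bij_betw h {..<card I} I" "strict_mono_on {..<card I} h"
    using ex_strict_mono_enumeration[OF finI] by blast
  obtain h' where h': "bij_betw h' {..<card X} X" "strict_mono_on {..<card X} h'"
    using ex_strict_mono_enumeration[OF finX] by blast
  define \<epsilon> where "\<epsilon> = card X"
  define \<iota> where "\<iota> = card I"
  \<comment> \<open>Both enumerations start at 0: the least internally active element gets label 1,
    the least externally active one gets label 0, and the latter then continue downwards.\<close>
  define m where "m j = (if 1 \<le> j then h (nat (j - 1)) else h' (nat (- j)))" for j :: int
  have mI: "m j \<in> I" if "j \<in> {1..int \<iota>}" for j
    using that bij_betwE[OF h(1)] by (auto simp: m_def \<iota>_def)
  have mX: "m j \<in> X" if "j \<in> {1 - int \<epsilon>..0}" for j
    using that bij_betwE[OF h'(1)] by (auto simp: m_def \<epsilon>_def)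
  have inc: "m i < m j" if "1 \<le> i" "i < j" "j \<le> int \<iota>" for i j
    using strict_mono_onD[OF h(2), of "nat (i - 1)" "nat (j - 1)"] that by (auto simp: m_def \<iota>_def)
  have dec: "m j < m i" if "1 - int \<epsilon> \<le> i" "i < j" "j \<le> 0" for i j
    using strict_mono_onD[OF h'(2), of "nat (- j)" "nat (- i)"] that by (auto simp: m_def \<epsilon>_def)
  have ex_I: "\<exists>j \<in> {1..int \<iota>}. m j = x" if x: "x \<in> I" for x
  proof -
    have "x \<in> h ` {..<card I}" using bij_betw_imp_surj_on[OF h(1)] x by simp
    then obtain i where i: "i < card I" "h i = x" by blast
    then show ?thesis by (intro bexI[of _ "int i + 1"]) (auto simp: m_def \<iota>_def)
  qed
  have ex_X: "\<exists>j \<in> {1 - int \<epsilon>..0}. m j = x" if x: "x \<in> X" for x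
  proof -
    have "x \<in> h' ` {..<card X}" using bij_betw_imp_surj_on[OF h'(1)] x by simp
    then obtain i where i: "i < card X" "h' i = x" by blast
    then show ?thesis by (intro bexI[of _ "- int i"]) (auto simp: m_def \<epsilon>_def)
  qed
  have inj: "i = j"
    if ij: "i \<in> {1 - int \<epsilon>..int \<iota>}" "j \<in> {1 - int \<epsilon>..int \<iota>}" and eq: "m i = m j" for i j
  proof -
    have "I \<inter> X = {}" by (auto simp: I_def X_def)
    then have "\<not> (1 \<le> i \<and> j \<le> 0)" "\<not> (i \<le> 0 \<and> 1 \<le> j)"
      using mI[of i] mI[of j] mX[of i] mX[of j] ij eq by auto
    then consider "1 \<le> i" "1 \<le> j" | "i \<le> 0" "j \<le> 0" by linarith
    then have "\<not> i < j \<and> \<not> j < i"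
      using inc[of i j] inc[of j i] dec[of i j] dec[of j i] ij eq by cases auto
    then show ?thesis by simp
  qed
  define rank where "rank x = (THE j. j \<in> {1 - int \<epsilon>..int \<iota>} \<and> m j = x)" for x
  have rank_m: "rank (m j) = j" if "j \<in> {1 - int \<epsilon>..int \<iota>}" for j
    unfolding rank_def using that inj by (intro the_equality) auto
  \<comment> \<open>\<open>N\<close> is the set of labels of the smaller neighbours. It is empty
    only at active elements, where \<open>rank\<close> inverts \<open>m\<close>.\<close>
  let ?G = "\<lambda>x N. if N = {} then rank x else if x \<in> B then Min N else Max N"
  obtain lam where "\<forall>x \<in> E. lam x = ?G x (lam ` {y \<in> E. y < x \<and> (R x y \<or> R y x)})"
    using finite_linorder_recursion[OF fin, of ?G "\<lambda>x y. R x y \<or> R y x"] by blast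
  then have lam: "lam x = ?G x (lam ` {y \<in> E. y < x \<and> (R x y \<or> R y x)})" if "x \<in> E" for x
    using that by blast
  let ?N = "\<lambda>x. {y \<in> E. y < x \<and> (R x y \<or> R y x)}"
  have finN: "finite (lam ` ?N x)" for x using fin by simp
  have active: "x \<in> I \<union> X" if "x \<in> E" "?N x = {}" for x
  proof -
    have "x < y" if "R x y \<or> R y x" for y
    proof -
      have "y \<in> E" "y \<noteq> x" using that dom BE by blast+
      moreover have "\<not> y < x" using \<open>?N x = {}\<close> that \<open>y \<in> E\<close> by blast
      ultimately show ?thesis by simp
    qed
    then show ?thesis unfolding I_def X_def using that(1) by blast
  qed
  have N_m: "?N (m j) = {}" "m j \<in> E" if j: "j \<in> {1 - int \<epsilon>..int \<iota>}" for j
  proof -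
    have "m j \<in> I \<or> m j \<in> X" using mI[of j] mX[of j] j by (cases "1 \<le> j") auto
    then consider "m j \<in> I" | "m j \<in> X" by blast
    then show "?N (m j) = {}" "m j \<in> E"
      using dom BE unfolding I_def X_def by (cases; fastforce)+
  qed
  have lam_m: "lam (m j) = j" if "j \<in> {1 - int \<epsilon>..int \<iota>}" for j
    using lam[OF N_m(2)[OF that]] N_m(1)[OF that] rank_m[OF that] by simp
  \<comment> \<open>The minimum and maximum of a finite nonempty set of labels are attained.\<close>
  have nbr: "\<exists>y \<in> ?N x. lam y = lam x" if "x \<in> E" "?N x \<noteq> {}" for x
  proof -
    have "lam x \<in> lam ` ?N x"
      using lam[OF that(1)] Min_in[OF finN, of x] Max_in[OF finN, of x] that(2) by auto
    then show ?thesis by auto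
  qed
  have root: "\<exists>j \<in> {1 - int \<epsilon>..int \<iota>}. x = m j \<and> lam x = j" if "x \<in> E" "?N x = {}" for x
    using active[OF that] ex_I[of x] ex_X[of x] lam_m by fastforce
  \<comment> \<open>Smaller neighbours with the same label lead down to an element without smaller
    neighbours, which is \<open>m j\<close> with its own label \<open>j\<close>.\<close>
  have bounds: "lam x \<in> {1 - int \<epsilon>..int \<iota>} \<and> m (lam x) \<le> x" if "x \<in> E" for x
    using that
  proof (induction "card {y \<in> E. y < x}" arbitrary: x rule: less_induct)
    case less
    show ?case
    proof (cases "?N x = {}")
      case True
      then show ?thesis using root[OF less.prems] by auto
    next
      case False
      then obtain y where y: "y \<in> E" "y < x" "lam y = lam x" using nbr[OF less.prems] by auto
      have "{z \<in> E. z < y} \<subset> {z \<in> E. z < x}" using y by auto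
      then have "card {z \<in> E. z < y} < card {z \<in> E. z < x}"
        using fin by (intro psubset_card_mono) auto
      then show ?thesis using less.hyps[OF _ y(1)] y by fastforce
    qed
  qed
  have "active_labelling E B R lam m \<epsilon> \<iota>"
  proof
    \<comment> \<open>The larger end was labelled later and saw the label of the other: if it is
      \<open>e\<close>, it took a maximum over labels including \<open>lam b\<close>; if it is
      \<open>b\<close>, it took a minimum over labels including \<open>lam e\<close>.\<close>
    show "lam b \<le> lam e" if R: "R b e" for b e
    proof (cases "b < e")
      case True
      then have "b \<in> ?N e" using R dom BE by blast
      then have "lam b \<in> lam ` ?N e" "lam ` ?N e \<noteq> {}" by blast+
      moreover have "e \<in> E" "e \<notin> B" using dom[OF R] by auto
      then have "lam e = Max (lam ` ?N e)"
        using lam[of e] calculation(2) by (simp only: if_False)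
      ultimately show ?thesis using Max_ge[OF finN[of e]] by (simp only:)
    next
      case False
      then have "e \<in> ?N b" using R dom[OF R] by (auto simp: not_less order.strict_iff_order)
      then have "lam e \<in> lam ` ?N b" "lam ` ?N b \<noteq> {}" by blast+
      moreover have "b \<in> E" "b \<in> B" using dom[OF R] BE by auto
      then have "lam b = Min (lam ` ?N b)"
        using lam[of b] calculation(2) by (simp only: if_False if_True)
      ultimately show ?thesis using Min_le[OF finN[of b]] by (simp only:)
    qed
    show "\<exists>y < x. lam y = lam x \<and> (R x y \<or> R y x)" if "x \<in> E" "x \<noteq> m (lam x)" for x
      using nbr[OF that(1)] root[OF that(1)] that(2) by fastforce
  qed (use fin BE dom bounds N_m(2) lam_m mI mX inc dec in \<open>auto simp: I_def X_def\<close>)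
  then show ?thesis by blast
qed

section \<open>The active filtration\<close>

definition level_filt :: "'a set \<Rightarrow> ('a \<Rightarrow> int) \<Rightarrow> nat \<Rightarrow> nat \<Rightarrow> 'a filt" where
  "level_filt E lam \<epsilon> \<iota> =
    (map (\<lambda>k. {x \<in> E. lam x \<le> - int k}) [0..<\<epsilon> + 1], {x \<in> E. lam x \<le> 0},
     map (\<lambda>k. {x \<in> E. lam x \<le> int k}) [0..<\<iota> + 1])"

text \<open>The fundamental cocircuit is the neighbourhood of \<open>b\<close> together with
  \<open>b\<close>. This extra element is not below \<open>b\<close>, and the first closure rule
  concerns only sets that already contain it.\<close>

lemma acl_int_eq:
  assumes "is_matroid M" "basis M B"
  shows "acl_int M B X = graph_acl (ground M) B (exch M B) X"
proof -
  have fc: "fund_cocircuit M B b = insert b {e. exch M B b e}" if "b \<in> B" for b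
    using fund_cocircuit_eq[OF assms that] .
  have "{e \<in> fund_cocircuit M B b. e < b} = {e. exch M B b e \<and> e < b}" if "b \<in> B" for b
    using fc[OF that] by auto
  moreover have "fund_cocircuit M B b \<subseteq> A \<longleftrightarrow> {e. exch M B b e} \<subseteq> A" if "b \<in> B \<inter> A" for A b
    using fc[of b] that by simp
  ultimately show ?thesis
    unfolding acl_int_def graph_acl_def
    by (intro arg_cong[where f = Least] ext conj_cong ball_cong refl) (simp_all only: simp_thms)
qed

lemma acl_ext_eq:
  assumes "is_matroid M" "basis M B"
  shows "acl_ext M B X = graph_acl (ground M) (ground M - B) (\<lambda>e b. exch M B b e) X"
proof -
  have fc: "fund_circuit M B e = insert e {b. exch M B b e}" if "e \<in> ground M - B" for e
    using fund_circuit_eq[OF assms that] .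
  have "{b \<in> fund_circuit M B e. b < e} = {b. exch M B b e \<and> b < e}" if "e \<in> ground M - B" for e
    using fc[OF that] by auto
  moreover have "fund_circuit M B e \<subseteq> A \<longleftrightarrow> {b. exch M B b e} \<subseteq> A"
    if "e \<in> (ground M - B) \<inter> A" for A e
    using fc[of e] that by simp
  ultimately show ?thesis
    unfolding acl_ext_def graph_acl_def
    by (intro arg_cong[where f = Least] ext conj_cong ball_cong refl) (simp_all only: simp_thms)
qed

lemma nth_map_upt_0: "i \<le> n \<Longrightarrow> map f [0..<n + 1] ! i = f i"
  by (subst nth_map_upt) auto

lemma set_drop_map_upt:
  "set (drop k (map (\<lambda>k. f (int k)) [1..<n + 1])) = f ` {int k + 1..int n}"
proof -
  have "drop k (map (\<lambda>k. f (int k)) [1..<n + 1]) = map (\<lambda>k. f (int k)) [k + 1..<n + 1]"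
    by (simp only: drop_map drop_upt add.commute)
  then have "set (drop k (map (\<lambda>k. f (int k)) [1..<n + 1])) = f ` int ` {k + 1..<n + 1}"
    by (simp only: set_map set_upt image_image)
  also have "int ` {k + 1..<n + 1} = {int k + 1..int n}"
    using image_int_atLeastAtMost[of "k + 1" n] by (simp add: atLeastLessThanSuc_atLeastAtMost add.commute)
  finally show ?thesis .
qed

section \<open>Levels and blocks of a labelled basis\<close>

locale labelled_basis = active_labelling "ground M" B "exch M B" lam m \<epsilon> \<iota>
  for M :: "'a::linorder matroid" and B lam m \<epsilon> \<iota> +
  assumes matroid: "is_matroid M" and basis: "basis M B"
begin

abbreviation level :: "int \<Rightarrow> 'a set" where
  "level j \<equiv> {x \<in> ground M. lam x \<le> j}"

abbreviation block :: "int \<Rightarrow> 'a set" where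
  "block j \<equiv> {x \<in> ground M. lam x = j}"

abbreviation block_minor :: "int \<Rightarrow> 'a matroid" where
  "block_minor j \<equiv> minor M (level j) (level (j - 1))"

lemma int_set_image: "int_set M B = m ` {1..int \<iota>}"
  using internally_active int_set_eq[OF matroid basis] by simp

lemma ext_set_image: "ext_set M B = (\<lambda>j. m (1 - j)) ` {1..int \<epsilon>}"
  using active_labelling.internally_active[OF dual_labelling] ext_set_eq[OF matroid basis] by simp

text \<open>The active elements in increasing order are the values of \<open>m\<close>, so dropping
  \<open>k\<close> of them leaves the generators in \<open>graph_acl_internal\<close>, applied to
  the labelling and to its dual.\<close>

lemma active_filtration_eq: "active_filtration M B = level_filt (ground M) lam \<epsilon> \<iota>"
proof -
  define a where "a = map (\<lambda>k. m (int k)) [1..<\<iota> + 1]"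
  define a' where "a' = map (\<lambda>k. m (1 - int k)) [1..<\<epsilon> + 1]"
  have a: "sorted_list_of_set (int_set M B) = a" "length a = \<iota>"
    and a': "sorted_list_of_set (ext_set M B) = a'" "length a' = \<epsilon>"
    using sorted_list_internal active_labelling.sorted_list_internal[OF dual_labelling]
    by (simp_all add: a_def a'_def int_set_image ext_set_image del: upt_Suc)
  have int: "acl_int M B (set (drop k a)) = {x \<in> ground M. int k < lam x}" for k
    unfolding a_def set_drop_map_upt acl_int_eq[OF matroid basis]
    by (rule graph_acl_internal) simp
  have ext: "acl_ext M B (set (drop k a')) = level (- int k)" for k
  proof -
    have "acl_ext M B (set (drop k a')) = {x \<in> ground M. int k < 1 - lam x}"
      unfolding a'_def set_drop_map_upt[of k "\<lambda>j. m (1 - j)"] acl_ext_eq[OF matroid basis]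
      by (rule active_labelling.graph_acl_internal[OF dual_labelling]) simp
    moreover have "int k < 1 - lam x \<longleftrightarrow> lam x \<le> - int k" for x by linarith
    ultimately show ?thesis by simp
  qed
  have "finite (ext_set M B)" by (simp add: ext_set_image)
  then have "set a' = ext_set M B" using a'(1) set_sorted_list_of_set by metis
  then have "acl_ext M B (ext_set M B) = level 0" using ext[of 0] by simp
  \<comment> \<open>The two end entries, set separately in \<open>active_filtration\<close>, agree
    with the levels because of the range of labels.\<close>
  moreover have "level (- int \<epsilon>) = {}" "level (int \<iota>) = ground M"
    using lam_range by force+
  moreover have "ground M - {x \<in> ground M. int k < lam x} = level (int k)" for k by auto
  ultimately show ?thesis
    unfolding active_filtration_def level_filt_def Let_def a a' int ext
    by (auto simp del: upt_Suc intro!: map_cong)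
qed

lemma level_diff: "level j - level (j - 1) = block j"
  by auto

lemma basis_level: "basis (restriction M (level j)) (B \<inter> level j)"
proof -
  have "b \<in> level j" if "exch M B b e" "e \<in> level j" for b e
    using R_dom[OF that(1)] lam_mono[OF that(1)] that(2) B_sub by auto
  then show ?thesis
    using basis_restriction_Int_iff[OF matroid basis, of "level j"] by blast
qed

lemma exch_block:
  "exch (block_minor j) (B \<inter> block j) b e \<longleftrightarrow> exch M B b e \<and> b \<in> block j \<and> e \<in> block j"
proof -
  have "level (j - 1) \<subseteq> level j" "level j \<subseteq> ground M" by auto
  from exch_minor_iff[OF matroid basis this basis_level basis_level] show ?thesis
    unfolding level_diff .
qed

lemma matroid_block: "is_matroid (block_minor j)"
  by (rule is_matroid_minor[OF matroid _ _ basis_level]) auto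

lemma basis_block: "basis (block_minor j) (B \<inter> block j)"
proof -
  have union: "B \<inter> level (j - 1) \<union> B \<inter> block j = B \<inter> level j" by auto
  have "level (j - 1) \<subseteq> level j" "level j \<subseteq> ground M" by auto
  then show ?thesis
    using basis_level[of j] by (simp only: basis_minor_iff[OF matroid _ _ basis_level] level_diff union) simp
qed

context
  fixes j :: int
  assumes j: "j \<in> {1 - int \<epsilon>..int \<iota>}"
begin

lemma m_block: "m j \<in> block j"
  using m_in lam_m j by auto

lemma m_block_le: "x \<in> block j \<Longrightarrow> m j \<le> x"
  using m_least by auto

lemma Min_block: "Min (level j - level (j - 1)) = m j"
  unfolding level_diff using m_block m_block_le fin by (intro Min_eqI) auto

lemma block_desc:
  assumes "x \<in> block j" "x \<noteq> m j"
  shows "\<exists>y \<in> block j. y < x \<and>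
    (exch (block_minor j) (B \<inter> block j) x y \<or> exch (block_minor j) (B \<inter> block j) y x)"
proof -
  obtain y where y: "y < x" "lam y = j" "exch M B x y \<or> exch M B y x"
    using desc[of x] assms by auto
  then have "y \<in> block j" using R_dom B_sub by blast
  then have "exch (block_minor j) (B \<inter> block j) x y \<or> exch (block_minor j) (B \<inter> block j) y x"
    unfolding exch_block using y assms(1) by blast
  then show ?thesis using \<open>y \<in> block j\<close> y(1) by blast
qed

lemma connected_block: "connected_matroid (block_minor j)"
  using connected_matroid_if_descent[OF matroid_block basis_block, of j "m j"] block_desc
  unfolding ground_minor level_diff by blast

text \<open>By \<open>block_desc\<close> every other element of the block has a smaller neighbour
  inside the block. The element \<open>m j\<close> is below all its neighbours there, so only its
  membership in \<open>B\<close> decides the kind of activity.\<close>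

lemma int_set_block: "int_set (block_minor j) (B \<inter> block j) = {m j} \<inter> B"
  unfolding int_set_eq[OF matroid_block basis_block]
proof (intro equalityI subsetI)
  fix b assume b: "b \<in> {b \<in> B \<inter> block j. \<forall>e. exch (block_minor j) (B \<inter> block j) b e \<longrightarrow> b < e}"
  have "b = m j"
  proof (rule ccontr)
    assume "b \<noteq> m j"
    then obtain y where y: "y < b" "exch (block_minor j) (B \<inter> block j) b y \<or>
        exch (block_minor j) (B \<inter> block j) y b"
      using block_desc[of b] b by auto
    have "\<not> exch (block_minor j) (B \<inter> block j) y b" using b by (auto simp: exch_def)
    then have "b < y" using y b by blast
    then show False using y by simp
  qed
  then show "b \<in> {m j} \<inter> B" using b by auto
next
  fix b assume b: "b \<in> {m j} \<inter> B"
  have "m j < e" if "exch M B (m j) e" "e \<in> block j" for e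
    using m_block_le[OF that(2)] R_dom[OF that(1)] by (cases "e = m j") auto
  then show "b \<in> {b \<in> B \<inter> block j. \<forall>e. exch (block_minor j) (B \<inter> block j) b e \<longrightarrow> b < e}"
    unfolding exch_block using b m_block by auto
qed

lemma ext_set_block: "ext_set (block_minor j) (B \<inter> block j) = {m j} - B"
  unfolding ext_set_eq[OF matroid_block basis_block] ground_minor level_diff
proof (intro equalityI subsetI)
  fix e assume e: "e \<in> {e \<in> block j - B \<inter> block j.
    \<forall>b. exch (block_minor j) (B \<inter> block j) b e \<longrightarrow> e < b}"
  have "e = m j"
  proof (rule ccontr)
    assume "e \<noteq> m j"
    then obtain y where y: "y < e" "exch (block_minor j) (B \<inter> block j) e y \<or>
        exch (block_minor j) (B \<inter> block j) y e"
      using block_desc[of e] e by auto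
    have "\<not> exch (block_minor j) (B \<inter> block j) e y" using e by (auto simp: exch_def)
    then have "e < y" using y e by blast
    then show False using y by simp
  qed
  then show "e \<in> {m j} - B" using e by auto
next
  fix e assume e: "e \<in> {m j} - B"
  have "m j < b" if "exch M B b (m j)" "b \<in> block j" for b
    using m_block_le[OF that(2)] R_dom[OF that(1)] by (cases "b = m j") auto
  then show "e \<in> {e \<in> block j - B \<inter> block j.
      \<forall>b. exch (block_minor j) (B \<inter> block j) b e \<longrightarrow> e < b}"
    unfolding exch_block using e m_block by auto
qed

lemma block_not_loop:
  assumes "m j \<in> B"
  shows "\<not> is_loop (block_minor j)"
proof
  assume "is_loop (block_minor j)"
  then have "circuit (block_minor j) {m j}"
    using m_block unfolding is_loop_def ground_minor level_diff by force
  moreover have "{m j} \<in> indeps (block_minor j)"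
    using indep_mono[OF matroid_block basis_indep[OF matroid_block basis_block]] m_block assms by auto
  ultimately show False by (simp add: circuit_def)
qed

lemma block_not_isthmus:
  assumes "m j \<notin> B"
  shows "\<not> is_isthmus (block_minor j)"
proof
  assume "is_isthmus (block_minor j)"
  then have "cocircuit (block_minor j) {m j}"
    using m_block unfolding is_isthmus_def ground_minor level_diff by force
  moreover have "{m j} \<inter> (B \<inter> block j) = {}" using assms by auto
  ultimately show False
    using basis_block[of j] unfolding cocircuit_def circuit_def dual_def by auto
qed

lemma level_psubset: "level (j - 1) \<subset> level j"
proof -
  have "m j \<in> level j - level (j - 1)" unfolding level_diff by (rule m_block)
  moreover have "level (j - 1) \<subseteq> level j" by auto
  ultimately show ?thesis by blast
qed

end

lemma level_nth:
  assumes "k \<in> {1..\<iota>}"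
  shows "map (\<lambda>k. level (int k)) [0..<\<iota> + 1] ! k = level (int k)"
    "map (\<lambda>k. level (int k)) [0..<\<iota> + 1] ! (k - 1) = level (int k - 1)"
proof -
  have "k \<le> \<iota>" "k - 1 \<le> \<iota>" "int (k - 1) = int k - 1" using assms by auto
  then show "map (\<lambda>k. level (int k)) [0..<\<iota> + 1] ! k = level (int k)"
    "map (\<lambda>k. level (int k)) [0..<\<iota> + 1] ! (k - 1) = level (int k - 1)"
    by (simp_all only: nth_map_upt_0)
qed

text \<open>The lower level is written with \<open>1 - int k - 1\<close> so that step
  \<open>k\<close> of the first list matches \<open>block_minor (1 - int k)\<close>
  literally.\<close>

lemma level_nth':
  assumes "k \<in> {1..\<epsilon>}"
  shows "map (\<lambda>k. level (- int k)) [0..<\<epsilon> + 1] ! (k - 1) = level (1 - int k)"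
    "map (\<lambda>k. level (- int k)) [0..<\<epsilon> + 1] ! k = level (1 - int k - 1)"
proof -
  have "k \<le> \<epsilon>" "k - 1 \<le> \<epsilon>" "- int (k - 1) = 1 - int k" "- int k = 1 - int k - 1"
    using assms by auto
  then show "map (\<lambda>k. level (- int k)) [0..<\<epsilon> + 1] ! (k - 1) = level (1 - int k)"
    "map (\<lambda>k. level (- int k)) [0..<\<epsilon> + 1] ! k = level (1 - int k - 1)"
    by (simp_all only: nth_map_upt_0)
qed

lemma index_range:
  "k \<in> {1..\<iota>} \<Longrightarrow> int k \<in> {1 - int \<epsilon>..int \<iota>}" "k \<in> {1..\<iota>} \<Longrightarrow> int k \<in> {1..int \<iota>}"
  "k \<in> {1..\<epsilon>} \<Longrightarrow> 1 - int k \<in> {1 - int \<epsilon>..int \<iota>}" "k \<in> {1..\<epsilon>} \<Longrightarrow> 1 - int k \<in> {1 - int \<epsilon>..0}"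
  by auto

lemma connected_filtration_level: "connected_filtration M (level_filt (ground M) lam \<epsilon> \<iota>)"
proof -
  let ?F = "map (\<lambda>k. level (int k)) [0..<\<iota> + 1]"
  let ?F' = "map (\<lambda>k. level (- int k)) [0..<\<epsilon> + 1]"
  have len: "length ?F = \<iota> + 1" "length ?F' = \<epsilon> + 1" by simp_all
  have ends: "?F' ! \<epsilon> = {}" "?F' ! 0 = level 0" "level 0 = ?F ! 0" "?F ! \<iota> = ground M"
    using lam_range by (force simp: nth_map_upt simp del: upt_Suc)+
  have "?F ! (k - 1) \<subset> ?F ! k" if "k \<in> {1..\<iota>}" for k
    unfolding level_nth[OF that] by (rule level_psubset[OF index_range(1)[OF that]])
  moreover have "?F' ! k \<subset> ?F' ! (k - 1)" if "k \<in> {1..\<epsilon>}" for k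
    unfolding level_nth'[OF that] by (rule level_psubset[OF index_range(3)[OF that]])
  moreover have min: "Min (?F ! k - ?F ! (k - 1)) = m (int k)" if "k \<in> {1..\<iota>}" for k
    unfolding level_nth[OF that] by (rule Min_block[OF index_range(1)[OF that]])
  moreover have min': "Min (?F' ! (k - 1) - ?F' ! k) = m (1 - int k)" if "k \<in> {1..\<epsilon>}" for k
    unfolding level_nth'[OF that] by (rule Min_block[OF index_range(3)[OF that]])
  moreover have "strict_mono_on {1..\<iota>} (\<lambda>k. Min (?F ! k - ?F ! (k - 1)))"
    by (rule strict_mono_onI, simp only: min) (auto intro: m_inc)
  moreover have "strict_mono_on {1..\<epsilon>} (\<lambda>k. Min (?F' ! (k - 1) - ?F' ! k))"
    by (rule strict_mono_onI, simp only: min') (auto intro: m_dec)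
  ultimately have "filtration M (?F', level 0, ?F)"
    unfolding filtration_def using len ends by blast
  moreover have "connected_matroid (minor M (?F ! k) (?F ! (k - 1))) \<and>
      \<not> is_loop (minor M (?F ! k) (?F ! (k - 1)))" if "k \<in> {1..\<iota>}" for k
    unfolding level_nth[OF that]
    using connected_block block_not_loop m_int index_range(1,2)[OF that] by blast
  moreover have "connected_matroid (minor M (?F' ! (k - 1)) (?F' ! k)) \<and>
      \<not> is_isthmus (minor M (?F' ! (k - 1)) (?F' ! k))" if "k \<in> {1..\<epsilon>}" for k
    unfolding level_nth'[OF that]
    using connected_block block_not_isthmus m_ext index_range(3,4)[OF that] by blast
  ultimately show ?thesis
    unfolding connected_filtration_def level_filt_def prod.case len add_diff_cancel_right' by blast
qed

lemma minor_bases_level: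
  "minor_bases M (level_filt (ground M) lam \<epsilon> \<iota>) (\<lambda>k. B \<inter> block (1 - int k)) (\<lambda>k. B \<inter> block (int k))"
proof -
  let ?F = "map (\<lambda>k. level (int k)) [0..<\<iota> + 1]"
  let ?F' = "map (\<lambda>k. level (- int k)) [0..<\<epsilon> + 1]"
  have len: "length ?F = \<iota> + 1" "length ?F' = \<epsilon> + 1" by simp_all
  have "int_set (block_minor j) (B \<inter> block j) = {m j} \<and> ext_set (block_minor j) (B \<inter> block j) = {}"
    if "j \<in> {1..int \<iota>}" for j
    using int_set_block[of j] ext_set_block[of j] m_int[OF that] that by auto
  moreover have "int_set (block_minor j) (B \<inter> block j) = {} \<and> ext_set (block_minor j) (B \<inter> block j) = {m j}"
    if "j \<in> {1 - int \<epsilon>..0}" for j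
    using int_set_block[of j] ext_set_block[of j] m_ext[OF that] that by auto
  ultimately show ?thesis
    unfolding minor_bases_def level_filt_def prod.case len add_diff_cancel_right'
      int_activity_def ext_activity_def
    using index_range(2,4) basis_block
    by (simp only: level_nth level_nth' card.empty is_singletonI card_1_singleton_iff simp_thms ball_simps cong: ball_cong) auto
qed

lemma union_of_parts_level:
  "union_of_parts (level_filt (ground M) lam \<epsilon> \<iota>) (\<lambda>k. B \<inter> block (1 - int k)) (\<lambda>k. B \<inter> block (int k)) = B"
proof -
  have "x \<in> (\<Union>k \<in> {1..\<epsilon>}. B \<inter> block (1 - int k)) \<union> (\<Union>k \<in> {1..\<iota>}. B \<inter> block (int k))"
    if x: "x \<in> B" for x
  proof -
    have xE: "x \<in> ground M" using x B_sub by blast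
    show ?thesis
    \<comment> \<open>A positive label \<open>j\<close> belongs to part \<open>j\<close> of the
      upper list, a nonpositive one to part \<open>1 - j\<close> of the lower list.\<close>
    proof (cases "1 \<le> lam x")
      case True
      then have "x \<in> B \<inter> block (int (nat (lam x)))" "nat (lam x) \<in> {1..\<iota>}"
        using x xE lam_range[OF xE] by auto
      then show ?thesis by blast
    next
      case False
      then have "x \<in> B \<inter> block (1 - int (nat (1 - lam x)))" "nat (1 - lam x) \<in> {1..\<epsilon>}"
        using x xE lam_range[OF xE] by auto
      then show ?thesis by blast
    qed
  qed
  then show ?thesis
    unfolding union_of_parts_def level_filt_def prod.case by (simp del: upt_Suc) blast
qed

end

section \<open>Filtrations with uniactive bases of the minors\<close>

lemma indep_minor_subset: "X \<in> indeps (minor M G A) \<Longrightarrow> X \<subseteq> G - A"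
  by (auto simp: minor_def contraction_def restriction_def)

text \<open>The least element is below all its neighbours. In a uniactive minor it must therefore be
  the one active element, which fixes its side with respect to the basis.\<close>

lemma Min_ground_active:
  assumes M: "is_matroid M" and B: "basis M B" and ne: "ground M \<noteq> {}"
  shows "Min (ground M) \<in> int_set M B \<union> ext_set M B"
proof -
  let ?m = "Min (ground M)"
  have m: "?m \<in> ground M" using finite_ground[OF M] ne by simp
  have less: "?m < x" if "x \<in> ground M" "x \<noteq> ?m" for x
    using Min_le[OF finite_ground[OF M] that(1)] that(2) by simp
  have BE: "B \<subseteq> ground M" using indep_ground[OF M basis_indep[OF M B]] .
  show ?thesis
  proof (cases "?m \<in> B")
    case True
    have "?m < e" if "exch M B ?m e" for e
      using that True by (intro less) (auto simp: exch_def)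
    then show ?thesis using True unfolding int_set_eq[OF M B] by blast
  next
    case False
    have "?m < b" if "exch M B b ?m" for b
      using that False BE by (intro less) (auto simp: exch_def)
    then show ?thesis using m False unfolding ext_set_eq[OF M B] by blast
  qed
qed

lemma inactive_desc:
  assumes M: "is_matroid M" and B: "basis M B"
    and x: "x \<in> ground M" "x \<notin> int_set M B \<union> ext_set M B"
  shows "\<exists>y < x. exch M B x y \<or> exch M B y x"
proof (cases "x \<in> B")
  case True
  then obtain y where "exch M B x y" "\<not> x < y" using x unfolding int_set_eq[OF M B] by blast
  then show ?thesis by (intro exI[of _ y]) (auto simp: exch_def not_less order.strict_iff_order)
next
  case False
  then obtain y where "exch M B y x" "\<not> x < y" using x unfolding ext_set_eq[OF M B] by blast
  then show ?thesis by (intro exI[of _ y]) (auto simp: exch_def not_less order.strict_iff_order)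
qed

section \<open>Recovering the labelling from a filtration\<close>

text \<open>Gluing the given bases step by step makes \<open>B\<close> meet every set of the
  filtration in a basis of it. Hence the labels are monotone along edges and the minors have the
  induced fundamental graphs; the activities of the parts then supply the remaining
  conditions.\<close>

lemma labelled_basis_of_parts:
  fixes M :: "'a::linorder matroid"
  assumes M: "is_matroid M"
    and cf: "connected_filtration M (F', Fc, F)"
    and mb: "minor_bases M (F', Fc, F) Bs' Bs"
    and B: "B = union_of_parts (F', Fc, F) Bs' Bs"
  obtains lam m \<epsilon> \<iota> where "labelled_basis M B lam m \<epsilon> \<iota>"
    and "(F', Fc, F) = level_filt (ground M) lam \<epsilon> \<iota>"
    and "\<And>k. k \<in> {1..\<epsilon>} \<Longrightarrow> Bs' k = B \<inter> {x \<in> ground M. lam x = 1 - int k}"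
    and "\<And>k. k \<in> {1..\<iota>} \<Longrightarrow> Bs k = B \<inter> {x \<in> ground M. lam x = int k}"
proof -
  have "filtration M (F', Fc, F)" using cf by (simp add: connected_filtration_def)
  then obtain \<epsilon> \<iota> where filt: "length F' = \<epsilon> + 1 \<and> length F = \<iota> + 1 \<and> F' ! \<epsilon> = {} \<and>
     (\<forall>k \<in> {1..\<epsilon>}. F' ! k \<subset> F' ! (k - 1)) \<and> F' ! 0 = Fc \<and> Fc = F ! 0 \<and>
     (\<forall>k \<in> {1..\<iota>}. F ! (k - 1) \<subset> F ! k) \<and> F ! \<iota> = ground M \<and>
     strict_mono_on {1..\<iota>} (\<lambda>k. Min (F ! k - F ! (k - 1))) \<and>
     strict_mono_on {1..\<epsilon>} (\<lambda>k. Min (F' ! (k - 1) - F' ! k))"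
    unfolding filtration_def prod.case by (elim exE)
  have len: "length F' = \<epsilon> + 1" "length F = \<iota> + 1"
    and ends: "F' ! \<epsilon> = {}" "F' ! 0 = Fc" "Fc = F ! 0" "F ! \<iota> = ground M"
    and inc: "strict_mono_on {1..\<iota>} (\<lambda>k. Min (F ! k - F ! (k - 1)))"
    and inc': "strict_mono_on {1..\<epsilon>} (\<lambda>k. Min (F' ! (k - 1) - F' ! k))"
    using filt by simp_all
  have step': "F' ! k \<subset> F' ! (k - 1)" if "k \<in> {1..\<epsilon>}" for k
  proof -
    have "\<forall>k \<in> {1..\<epsilon>}. F' ! k \<subset> F' ! (k - 1)" using filt by (elim conjE)
    then show ?thesis using that by (rule bspec)
  qed
  have step: "F ! (k - 1) \<subset> F ! k" if "k \<in> {1..\<iota>}" for k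
  proof -
    have "\<forall>k \<in> {1..\<iota>}. F ! (k - 1) \<subset> F ! k" using filt by (elim conjE)
    then show ?thesis using that by (rule bspec)
  qed
  have parts': "basis (minor M (F' ! (k - 1)) (F' ! k)) (Bs' k) \<and>
      card (int_set (minor M (F' ! (k - 1)) (F' ! k)) (Bs' k)) = 0 \<and>
      card (ext_set (minor M (F' ! (k - 1)) (F' ! k)) (Bs' k)) = 1" if "k \<in> {1..\<epsilon>}" for k
    using mb that len by (simp add: minor_bases_def int_activity_def ext_activity_def)
  have parts: "basis (minor M (F ! k) (F ! (k - 1))) (Bs k) \<and>
      card (int_set (minor M (F ! k) (F ! (k - 1))) (Bs k)) = 1 \<and>
      card (ext_set (minor M (F ! k) (F ! (k - 1))) (Bs k)) = 0" if "k \<in> {1..\<iota>}" for k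
    using mb that len by (simp add: minor_bases_def int_activity_def ext_activity_def)
  have B_parts: "B = (\<Union>k \<in> {1..\<epsilon>}. Bs' k) \<union> (\<Union>k \<in> {1..\<iota>}. Bs k)"
    using B len by (simp add: union_of_parts_def)
  \<comment> \<open>Both lists become one chain from \<open>- int \<epsilon>\<close> to
    \<open>int \<iota>\<close>; they agree at 0, where each has the entry \<open>Fc\<close>. Below,
    \<open>bt j\<close> is the part belonging to the step from \<open>H (j - 1)\<close> to
    \<open>H j\<close>.\<close>
  define H where "H j = (if 0 \<le> j then F ! nat j else F' ! nat (- j))" for j :: int
  define bt where "bt j = (if 1 \<le> j then Bs (nat j) else Bs' (nat (1 - j)))" for j :: int
  define J where "J = {1 - int \<epsilon>..int \<iota>}"
  define D where "D j = H j - H (j - 1)" for j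
  define N where "N j = minor M (H j) (H (j - 1))" for j
  have H_int: "H (int k) = F ! k" for k by (simp add: H_def)
  have H_neg: "H (- int k) = F' ! k" for k using ends by (cases "k = 0") (auto simp: H_def)
  have H_pos: "H j = F ! nat j" "H (j - 1) = F ! (nat j - 1)" "nat j \<in> {1..\<iota>}"
    if "1 \<le> j" "j \<in> J" for j
    using that H_int[of "nat j"] H_int[of "nat j - 1"] by (auto simp: J_def of_nat_diff)
  have H_nonpos: "H j = F' ! (nat (1 - j) - 1)" "H (j - 1) = F' ! nat (1 - j)" "nat (1 - j) \<in> {1..\<epsilon>}"
    if "\<not> 1 \<le> j" "j \<in> J" for j
    using that H_neg[of "nat (1 - j)"] H_neg[of "nat (1 - j) - 1"] by (auto simp: J_def of_nat_diff)
  have H_step: "H (j - 1) \<subset> H j" if "j \<in> J" for j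
    using step[of "nat j"] step'[of "nat (1 - j)"] H_pos[of j] H_nonpos[of j] that by (cases "1 \<le> j") auto
  have bt: "basis (N j) (bt j)" if "j \<in> J" for j
    using parts[of "nat j"] parts'[of "nat (1 - j)"] H_pos[of j] H_nonpos[of j] that
    by (cases "1 \<le> j") (auto simp: N_def bt_def)
  have bt_pos: "card (int_set (N j) (bt j)) = 1" "card (ext_set (N j) (bt j)) = 0"
    if "1 \<le> j" "j \<in> J" for j
    using parts[of "nat j"] H_pos[of j] that by (auto simp: N_def bt_def)
  have bt_nonpos: "card (int_set (N j) (bt j)) = 0" "card (ext_set (N j) (bt j)) = 1"
    if "\<not> 1 \<le> j" "j \<in> J" for j
    using parts'[of "nat (1 - j)"] H_nonpos[of j] that by (auto simp: N_def bt_def)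
  have bot: "H (- int \<epsilon>) = {}" and top: "H (int \<iota>) = ground M"
    using H_neg H_int ends by auto
  have H_mono: "H i \<subseteq> H j" if "i \<le> j" "- int \<epsilon> \<le> i" "j \<le> int \<iota>" for i j
    using that
  proof (induction j rule: int_ge_induct)
    case (step j)
    then show ?case using H_step[of "j + 1"] by (auto simp: J_def)
  qed simp
  have H_ground: "H j \<subseteq> ground M" if "- int \<epsilon> \<le> j" "j \<le> int \<iota>" for j
    using H_mono[of j "int \<iota>"] that top by simp
  \<comment> \<open>The first set of the chain containing \<open>x\<close>. As the bottom set is
    empty, the value \<open>- int \<epsilon>\<close> does not occur on the ground set.\<close>
  define lam where "lam x = Min {j \<in> {- int \<epsilon>..int \<iota>}. x \<in> H j}" for x
  have H_iff: "x \<in> H j \<longleftrightarrow> lam x \<le> j" if x: "x \<in> ground M" and j: "- int \<epsilon> \<le> j" "j \<le> int \<iota>" for x j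
  proof -
    let ?S = "{j \<in> {- int \<epsilon>..int \<iota>}. x \<in> H j}"
    have fS: "finite ?S" by (rule finite_subset[of _ "{- int \<epsilon>..int \<iota>}"]) auto
    have "int \<iota> \<in> ?S" using x top by auto
    then have "lam x \<in> ?S" unfolding lam_def using fS by (intro Min_in) auto
    then show ?thesis
      using H_mono[of "lam x" j] j Min_le[OF fS, of j] unfolding lam_def[symmetric] by auto
  qed
  have lam_J: "lam x \<in> J" if "x \<in> ground M" for x
    using H_iff[OF that, of "- int \<epsilon>"] H_iff[OF that, of "int \<iota>"] that bot top by (auto simp: J_def)
  have H_eq: "H j = {x \<in> ground M. lam x \<le> j}" if "- int \<epsilon> \<le> j" "j \<le> int \<iota>" for j
    using H_iff H_ground that by blast
  have D_eq: "D j = {x \<in> ground M. lam x = j}" if "j \<in> J" for j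
    using H_eq[of j] H_eq[of "j - 1"] that by (auto simp: D_def J_def)
  have bt_D: "bt j \<subseteq> D j" if "j \<in> J" for j
  proof -
    have "bt j \<in> indeps (N j)" using bt[OF that] by (simp add: basis_def)
    then show ?thesis unfolding N_def D_def by (rule indep_minor_subset)
  qed
  \<comment> \<open>Partial unions, empty at the bottom index. By \<open>basis_minor_iff\<close>,
    adding the next part to a basis of \<open>H j\<close> gives a basis of
    \<open>H (j + 1)\<close>.\<close>
  define U where "U j = (\<Union>i \<in> {1 - int \<epsilon>..j}. bt i)" for j
  have U_basis: "basis (restriction M (H j)) (U j)" if "- int \<epsilon> \<le> j" "j \<le> int \<iota>" for j
    using that
  proof (induction j rule: int_ge_induct)
    case base
    have "U (- int \<epsilon>) = {}" by (simp add: U_def)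
    then show ?case using basis_restriction_iff[OF M, of "{}"] bot indep_empty[OF M] by simp
  next
    case (step j)
    have "{1 - int \<epsilon>..j + 1} = insert (j + 1) {1 - int \<epsilon>..j}" using step by auto
    then have "U (j + 1) = U j \<union> bt (j + 1)" by (auto simp: U_def)
    moreover have "j + 1 \<in> J" using step by (simp add: J_def)
    moreover have "basis (restriction M (H j)) (U j)" using step by simp
    ultimately show ?case
      using bt[of "j + 1"] H_step[of "j + 1"] H_ground[of "j + 1"] step.prems step.hyps
        basis_minor_iff[OF M, of "H j" "H (j + 1)" "U j" "bt (j + 1)"]
      by (simp add: N_def psubset_imp_subset)
  qed
  have B_U: "B = U (int \<iota>)"
  proof (intro equalityI subsetI)
    fix x assume "x \<in> B"
    then consider k where "k \<in> {1..\<epsilon>}" "x \<in> Bs' k" | k where "k \<in> {1..\<iota>}" "x \<in> Bs k"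
      using B_parts by blast
    then show "x \<in> U (int \<iota>)"
    proof cases
      case 1
      then have "x \<in> bt (1 - int k)" "1 - int k \<in> J" by (auto simp: bt_def J_def)
      then show ?thesis by (auto simp: U_def J_def)
    next
      case 2
      then have "x \<in> bt (int k)" "int k \<in> J" by (auto simp: bt_def J_def)
      then show ?thesis by (auto simp: U_def J_def)
    qed
  next
    fix x assume "x \<in> U (int \<iota>)"
    then obtain j where j: "j \<in> J" "x \<in> bt j" by (auto simp: U_def J_def)
    then show "x \<in> B"
      using B_parts H_pos(3)[of j] H_nonpos(3)[of j] by (cases "1 \<le> j") (auto simp: bt_def)
  qed
  have B_basis: "basis M B"
    using U_basis[of "int \<iota>"] B_U top restriction_ground[OF M] by simp
  have B_lam: "x \<in> B \<longleftrightarrow> x \<in> bt (lam x)" if "x \<in> ground M" for x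
  proof
    assume "x \<in> B"
    then obtain i where i: "i \<in> J" "x \<in> bt i" unfolding B_U U_def J_def by blast
    then show "x \<in> bt (lam x)" using bt_D[OF i(1)] D_eq[OF i(1)] by auto
  next
    assume "x \<in> bt (lam x)"
    then show "x \<in> B" unfolding B_U U_def using lam_J[OF that] unfolding J_def by blast
  qed
  have B_ground: "B \<subseteq> ground M" using indep_ground[OF M basis_indep[OF M B_basis]] .
  have bt_eq: "bt j = B \<inter> D j" if "j \<in> J" for j
    using B_lam bt_D[OF that] D_eq[OF that] by auto
  have U_eq: "U j = B \<inter> H j" if r: "- int \<epsilon> \<le> j" "j \<le> int \<iota>" for j
  proof (intro equalityI subsetI)
    fix x assume "x \<in> U j"
    then obtain i where i: "i \<in> J" "i \<le> j" "x \<in> bt i"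
      using r by (auto simp: U_def J_def)
    then show "x \<in> B \<inter> H j" using bt_eq[OF i(1)] D_eq[OF i(1)] H_eq[OF r] by auto
  next
    fix x assume x: "x \<in> B \<inter> H j"
    then have "x \<in> ground M" "lam x \<le> j" using H_eq[OF r] by auto
    then show "x \<in> U j" using x B_lam lam_J[of x] by (auto simp: U_def J_def)
  qed
  have BH: "basis (restriction M (H j)) (B \<inter> H j)" if "- int \<epsilon> \<le> j" "j \<le> int \<iota>" for j
    using U_basis[OF that] U_eq[OF that] by simp
  have exN: "exch (N j) (bt j) b e \<longleftrightarrow> exch M B b e \<and> b \<in> D j \<and> e \<in> D j"
    and mN: "is_matroid (N j)" if "j \<in> J" for j b e
  proof -
    have r: "- int \<epsilon> \<le> j - 1" "j - 1 \<le> int \<iota>" "- int \<epsilon> \<le> j" "j \<le> int \<iota>"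
      using that by (auto simp: J_def)
    have sub: "H (j - 1) \<subseteq> H j" using H_step[OF that] by blast
    show "exch (N j) (bt j) b e \<longleftrightarrow> exch M B b e \<and> b \<in> D j \<and> e \<in> D j"
      unfolding bt_eq[OF that] unfolding N_def D_def
      by (rule exch_minor_iff[OF M B_basis sub H_ground[OF r(3,4)] BH[OF r(1,2)] BH[OF r(3,4)]])
    show "is_matroid (N j)"
      unfolding N_def by (rule is_matroid_minor[OF M sub H_ground[OF r(3,4)] BH[OF r(1,2)]])
  qed
  define m where "m j = Min (D j)" for j
  have fE: "finite (ground M)" using finite_ground[OF M] .
  have gN: "ground (N j) = D j" for j by (simp add: N_def D_def)
  have m_D: "m j \<in> D j" and m_le: "x \<in> D j \<Longrightarrow> m j \<le> x" if "j \<in> J" for j x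
  proof -
    have "finite (D j)" "D j \<noteq> {}" using D_eq[OF that] H_step[OF that] fE by (auto simp: D_def)
    then show "m j \<in> D j" "x \<in> D j \<Longrightarrow> m j \<le> x" unfolding m_def by auto
  qed
  \<comment> \<open>With the prescribed activities this determines both active sets of the minor:
    one is \<open>{m j}\<close> and the other is empty.\<close>
  have m_active: "m j \<in> int_set (N j) (bt j) \<union> ext_set (N j) (bt j)" if "j \<in> J" for j
    using Min_ground_active[OF mN[OF that] bt[OF that]] m_D[OF that] unfolding gN m_def by blast
  have fin_sets: "finite (int_set (N j) (bt j))" "finite (ext_set (N j) (bt j))" if "j \<in> J" for j
  proof -
    have "bt j \<subseteq> ground M" "D j \<subseteq> ground M" using bt_D[OF that] D_eq[OF that] by auto
    then show "finite (int_set (N j) (bt j))" "finite (ext_set (N j) (bt j))"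
      by (auto intro!: finite_subset[OF _ fE] simp: int_set_def ext_set_def gN)
  qed
  have act_pos: "int_set (N j) (bt j) = {m j}" "ext_set (N j) (bt j) = {}" if "1 \<le> j" "j \<in> J" for j
    using bt_pos[OF that] fin_sets[OF that(2)] m_active[OF that(2)] by (auto simp: card_1_singleton_iff)
  have act_nonpos: "int_set (N j) (bt j) = {}" "ext_set (N j) (bt j) = {m j}" if "\<not> 1 \<le> j" "j \<in> J" for j
    using bt_nonpos[OF that] fin_sets[OF that(2)] m_active[OF that(2)] by (auto simp: card_1_singleton_iff)
  have m_pos: "m (int k) = Min (F ! k - F ! (k - 1))" if "k \<in> {1..\<iota>}" for k
    using H_pos[of "int k"] that by (auto simp: m_def D_def J_def)
  have m_nonpos: "m (1 - int k) = Min (F' ! (k - 1) - F' ! k)" if "k \<in> {1..\<epsilon>}" for k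
    using H_nonpos[of "1 - int k"] that by (auto simp: m_def D_def J_def)
  have "labelled_basis M B lam m \<epsilon> \<iota>"
  proof
    show "finite (ground M)" "B \<subseteq> ground M" "is_matroid M" "basis M B" by fact+
    show "b \<in> B \<and> e \<in> ground M - B" if "exch M B b e" for b e
      using that by (simp add: exch_def)
    \<comment> \<open>Since \<open>B\<close> meets \<open>H (lam e)\<close> in a basis of it, the
      edge from \<open>e\<close> cannot leave this set.\<close>
    show "lam b \<le> lam e" if be: "exch M B b e" for b e
    proof -
      have b: "b \<in> ground M" and e: "e \<in> ground M" using be B_ground by (auto simp: exch_def)
      have r: "- int \<epsilon> \<le> lam e" "lam e \<le> int \<iota>" using lam_J[OF e] by (auto simp: J_def)
      have "e \<in> H (lam e)" using H_eq[OF r] e by auto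
      then have "b \<in> H (lam e)"
        using be BH[OF r] basis_restriction_Int_iff[OF M B_basis H_ground[OF r]] by blast
      then show ?thesis using H_eq[OF r] by auto
    qed
    show "lam x \<in> {1 - int \<epsilon>..int \<iota>}" if "x \<in> ground M" for x
      using lam_J[OF that] unfolding J_def .
    show "m j \<in> ground M" "lam (m j) = j" if "j \<in> {1 - int \<epsilon>..int \<iota>}" for j
      using m_D[of j] D_eq[of j] that unfolding J_def by auto
    show "m (lam x) \<le> x" if "x \<in> ground M" for x
      using m_le[OF lam_J[OF that]] D_eq[OF lam_J[OF that]] that by auto
    show "m j \<in> B" if "j \<in> {1..int \<iota>}" for j
    proof -
      have j: "j \<in> J" "1 \<le> j" using that by (auto simp: J_def)
      then have "m j \<in> bt j" using act_pos[OF j(2,1)] by (auto simp: int_set_def)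
      then show ?thesis using bt_eq[OF j(1)] by auto
    qed
    show "m j \<notin> B" if "j \<in> {1 - int \<epsilon>..0}" for j
    proof -
      have j: "j \<in> J" "\<not> 1 \<le> j" using that by (auto simp: J_def)
      then have "m j \<notin> bt j" using act_nonpos[OF j(2,1)] by (auto simp: ext_set_def)
      then show ?thesis using bt_eq[OF j(1)] m_D[OF j(1)] by auto
    qed
    show "m i < m j" if "1 \<le> i" "i < j" "j \<le> int \<iota>" for i j
    proof -
      have "nat i \<in> {1..\<iota>}" "nat j \<in> {1..\<iota>}" "nat i < nat j" using that by auto
      then show ?thesis
        using strict_mono_onD[OF inc] m_pos[of "nat i"] m_pos[of "nat j"] that by simp
    qed
    show "m j < m i" if "1 - int \<epsilon> \<le> i" "i < j" "j \<le> 0" for i j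
    proof -
      have "nat (1 - i) \<in> {1..\<epsilon>}" "nat (1 - j) \<in> {1..\<epsilon>}" "nat (1 - j) < nat (1 - i)"
        using that by auto
      then show ?thesis
        using strict_mono_onD[OF inc'] m_nonpos[of "nat (1 - i)"] m_nonpos[of "nat (1 - j)"] that by simp
    qed
    show "\<exists>y < x. lam y = lam x \<and> (exch M B x y \<or> exch M B y x)"
      if x: "x \<in> ground M" "x \<noteq> m (lam x)" for x
    proof -
      let ?j = "lam x"
      have j: "?j \<in> J" using lam_J[OF x(1)] .
      \<comment> \<open>Being inactive in its minor, \<open>x\<close> has a smaller neighbour there.
        Edges of the minor are edges of the whole graph between elements of the same label.\<close>
      have "x \<notin> int_set (N ?j) (bt ?j) \<union> ext_set (N ?j) (bt ?j)"
        using act_pos[of ?j] act_nonpos[of ?j] j x(2) by (cases "1 \<le> ?j") auto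
      moreover have "x \<in> ground (N ?j)" unfolding gN D_eq[OF j] using x by simp
      ultimately obtain y where "y < x" "exch (N ?j) (bt ?j) x y \<or> exch (N ?j) (bt ?j) y x"
        using inactive_desc[OF mN[OF j] bt[OF j]] by blast
      then show ?thesis unfolding exN[OF j] D_eq[OF j] by blast
    qed
  qed
  moreover have "(F', Fc, F) = level_filt (ground M) lam \<epsilon> \<iota>"
  proof -
    have "F' ! k = {x \<in> ground M. lam x \<le> - int k}" if "k < \<epsilon> + 1" for k
      using H_neg[of k] H_eq[of "- int k"] that by simp
    then have "F' = map (\<lambda>k. {x \<in> ground M. lam x \<le> - int k}) [0..<\<epsilon> + 1]"
      using len by (intro nth_equalityI) (simp_all add: nth_map_upt_0 del: upt_Suc)
    moreover have "F ! k = {x \<in> ground M. lam x \<le> int k}" if "k < \<iota> + 1" for k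
      using H_int[of k] H_eq[of "int k"] that by simp
    then have "F = map (\<lambda>k. {x \<in> ground M. lam x \<le> int k}) [0..<\<iota> + 1]"
      using len by (intro nth_equalityI) (simp_all add: nth_map_upt_0 del: upt_Suc)
    moreover have "Fc = {x \<in> ground M. lam x \<le> 0}"
      using ends H_int[of 0] H_eq[of 0] by simp
    ultimately show ?thesis by (simp only: level_filt_def)
  qed
  moreover have "Bs' k = B \<inter> {x \<in> ground M. lam x = 1 - int k}" if "k \<in> {1..\<epsilon>}" for k
  proof -
    have "1 - int k \<in> J" "bt (1 - int k) = Bs' k" using that by (auto simp: J_def bt_def)
    then show ?thesis using bt_eq[of "1 - int k"] D_eq[of "1 - int k"] by simp
  qed
  moreover have "Bs k = B \<inter> {x \<in> ground M. lam x = int k}" if "k \<in> {1..\<iota>}" for k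
  proof -
    have "int k \<in> J" "bt (int k) = Bs k" using that by (auto simp: J_def bt_def)
    then show ?thesis using bt_eq[of "int k"] D_eq[of "int k"] by simp
  qed
  ultimately show ?thesis using that by blast
qed

section \<open>Assembling the decomposition\<close>

text \<open>All claims are read off the labelling supplied by
  \<open>labelled_basis_of_parts\<close>. In particular the filtration is a function of
  \<open>B\<close> alone, which is what makes the union over filtrations disjoint.\<close>

lemma parts_properties:
  fixes M :: "'a::linorder matroid"
  assumes M: "is_matroid M"
    and cf: "connected_filtration M (F', Fc, F)"
    and mb: "minor_bases M (F', Fc, F) Bs' Bs"
    and B: "B = union_of_parts (F', Fc, F) Bs' Bs"
  shows "basis M B"
    and "(F', Fc, F) = active_filtration M B"
    and "parts_disjoint (F', Fc, F) Bs' Bs"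
    and "int_set M B = (\<Union>k \<in> {1..length F - 1}. {Min (F ! k - F ! (k - 1))})"
    and "int_set M B = (\<Union>k \<in> {1..length F - 1}. int_set (minor M (F ! k) (F ! (k - 1))) (Bs k))"
    and "ext_set M B = (\<Union>k \<in> {1..length F' - 1}. {Min (F' ! (k - 1) - F' ! k)})"
    and "ext_set M B =
      (\<Union>k \<in> {1..length F' - 1}. ext_set (minor M (F' ! (k - 1)) (F' ! k)) (Bs' k))"
proof -
  obtain lam m \<epsilon> \<iota> where lb: "labelled_basis M B lam m \<epsilon> \<iota>"
    and filt: "(F', Fc, F) = level_filt (ground M) lam \<epsilon> \<iota>"
    and Bs': "\<And>k. k \<in> {1..\<epsilon>} \<Longrightarrow> Bs' k = B \<inter> {x \<in> ground M. lam x = 1 - int k}"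
    and Bs: "\<And>k. k \<in> {1..\<iota>} \<Longrightarrow> Bs k = B \<inter> {x \<in> ground M. lam x = int k}"
    by (rule labelled_basis_of_parts[OF M cf mb B]) (rule that; simp)
  interpret labelled_basis M B lam m \<epsilon> \<iota> by (fact lb)
  have F': "F' = map (\<lambda>k. level (- int k)) [0..<\<epsilon> + 1]"
    and F: "F = map (\<lambda>k. level (int k)) [0..<\<iota> + 1]"
    using filt by (simp_all add: level_filt_def del: upt_Suc)
  have len: "length F' - 1 = \<epsilon>" "length F - 1 = \<iota>" by (simp_all add: F F')
  show "basis M B" by (fact basis)
  show "(F', Fc, F) = active_filtration M B" using filt active_filtration_eq by simp
  show "parts_disjoint (F', Fc, F) Bs' Bs"
    unfolding parts_disjoint_def prod.case len disjoint_family_on_def using Bs Bs' by auto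
  have min: "Min (F ! k - F ! (k - 1)) = m (int k)" if "k \<in> {1..\<iota>}" for k
    unfolding F level_nth[OF that] by (rule Min_block[OF index_range(1)[OF that]])
  have min': "Min (F' ! (k - 1) - F' ! k) = m (1 - int k)" if "k \<in> {1..\<epsilon>}" for k
    unfolding F' level_nth'[OF that] by (rule Min_block[OF index_range(3)[OF that]])
  have int: "int_set (minor M (F ! k) (F ! (k - 1))) (Bs k) = {m (int k)}" if "k \<in> {1..\<iota>}" for k
    unfolding F level_nth[OF that] Bs[OF that] int_set_block[OF index_range(1)[OF that]]
    using m_int[OF index_range(2)[OF that]] by simp
  have ext: "ext_set (minor M (F' ! (k - 1)) (F' ! k)) (Bs' k) = {m (1 - int k)}"
    if "k \<in> {1..\<epsilon>}" for k
    unfolding F' level_nth'[OF that] Bs'[OF that] ext_set_block[OF index_range(3)[OF that]]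
    using m_ext[OF index_range(4)[OF that]] by blast
  have image: "f ` {1..int n} = (\<Union>k \<in> {1..n}. {f (int k)})" for f :: "int \<Rightarrow> 'a" and n
    using image_int_atLeastAtMost[of 1 n] by (metis UNION_singleton_eq_range image_image of_nat_1)
  have "(\<Union>k \<in> {1..\<iota>}. {Min (F ! k - F ! (k - 1))}) = (\<Union>k \<in> {1..\<iota>}. {m (int k)})"
    "(\<Union>k \<in> {1..\<iota>}. int_set (minor M (F ! k) (F ! (k - 1))) (Bs k)) = (\<Union>k \<in> {1..\<iota>}. {m (int k)})"
    by (intro SUP_cong refl; simp only: min int)+
  moreover have "int_set M B = (\<Union>k \<in> {1..\<iota>}. {m (int k)})"
    unfolding int_set_image by (rule image)
  ultimately show "int_set M B = (\<Union>k \<in> {1..length F - 1}. {Min (F ! k - F ! (k - 1))})"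
    and "int_set M B = (\<Union>k \<in> {1..length F - 1}. int_set (minor M (F ! k) (F ! (k - 1))) (Bs k))"
    unfolding len by (simp_all only:)
  have "(\<Union>k \<in> {1..\<epsilon>}. {Min (F' ! (k - 1) - F' ! k)}) = (\<Union>k \<in> {1..\<epsilon>}. {m (1 - int k)})"
    "(\<Union>k \<in> {1..\<epsilon>}. ext_set (minor M (F' ! (k - 1)) (F' ! k)) (Bs' k)) =
      (\<Union>k \<in> {1..\<epsilon>}. {m (1 - int k)})"
    by (intro SUP_cong refl; simp only: min' ext)+
  moreover have "ext_set M B = (\<Union>k \<in> {1..\<epsilon>}. {m (1 - int k)})"
    unfolding ext_set_image by (rule image)
  ultimately show "ext_set M B = (\<Union>k \<in> {1..length F' - 1}. {Min (F' ! (k - 1) - F' ! k)})"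
    and "ext_set M B =
      (\<Union>k \<in> {1..length F' - 1}. ext_set (minor M (F' ! (k - 1)) (F' ! k)) (Bs' k))"
    unfolding len by (simp_all only:)
qed

lemma ex_parts:
  fixes M :: "'a::linorder matroid"
  assumes M: "is_matroid M" and B: "basis M B"
  shows "\<exists>\<F> Bs' Bs. connected_filtration M \<F> \<and> minor_bases M \<F> Bs' Bs \<and> B = union_of_parts \<F> Bs' Bs"
proof -
  have "\<exists>lam m \<epsilon> \<iota>. active_labelling (ground M) B (exch M B) lam m \<epsilon> \<iota>"
    using finite_ground[OF M] indep_ground[OF M basis_indep[OF M B]]
    by (rule ex_active_labelling) (simp add: exch_def)
  then obtain lam m \<epsilon> \<iota> where "active_labelling (ground M) B (exch M B) lam m \<epsilon> \<iota>" by blast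
  then have "labelled_basis M B lam m \<epsilon> \<iota>"
    using M B by (simp add: labelled_basis_def labelled_basis_axioms_def)
  then interpret labelled_basis M B lam m \<epsilon> \<iota> .
  show ?thesis
    using connected_filtration_level minor_bases_level union_of_parts_level[symmetric] by blast
qed

theorem theorem4p25:
  fixes M :: "'a::linorder matroid"
  assumes "is_matroid M"
  shows
    "{B. basis M B} =
       (\<Union>\<F> \<in> {\<F>. connected_filtration M \<F>}.
          {union_of_parts \<F> B' B | B' B. minor_bases M \<F> B' B}) \<and>
     disjoint_family_on (\<lambda>\<F>. {union_of_parts \<F> B' B | B' B. minor_bases M \<F> B' B})
       {\<F>. connected_filtration M \<F>} \<and>
     (\<forall>F' Fc F Bs' Bs B.
        connected_filtration M (F', Fc, F) \<and> minor_bases M (F', Fc, F) Bs' Bs \<and>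
        B = union_of_parts (F', Fc, F) Bs' Bs \<longrightarrow>
          parts_disjoint (F', Fc, F) Bs' Bs \<and>
          int_set M B = (\<Union>k \<in> {1..length F - 1}. {Min (F ! k - F ! (k - 1))}) \<and>
          int_set M B =
            (\<Union>k \<in> {1..length F - 1}. int_set (minor M (F ! k) (F ! (k - 1))) (Bs k)) \<and>
          ext_set M B = (\<Union>k \<in> {1..length F' - 1}. {Min (F' ! (k - 1) - F' ! k)}) \<and>
          ext_set M B =
            (\<Union>k \<in> {1..length F' - 1}. ext_set (minor M (F' ! (k - 1)) (F' ! k)) (Bs' k)) \<and>
          (F', Fc, F) = active_filtration M B)"
proof (intro conjI)
  have parts: "basis M (union_of_parts \<F> Bs' Bs) \<and> \<F> = active_filtration M (union_of_parts \<F> Bs' Bs)"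
    if "connected_filtration M \<F>" "minor_bases M \<F> Bs' Bs" for \<F> Bs' Bs
  proof (cases \<F>)
    case (fields F' Fc F)
    have cf: "connected_filtration M (F', Fc, F)" and mb: "minor_bases M (F', Fc, F) Bs' Bs"
      using that unfolding fields .
    show ?thesis
      unfolding fields using parts_properties(1,2)[OF assms cf mb refl] by (rule conjI)
  qed
  show "{B. basis M B} = (\<Union>\<F> \<in> {\<F>. connected_filtration M \<F>}.
      {union_of_parts \<F> B' B | B' B. minor_bases M \<F> B' B})"
  proof (intro equalityI subsetI)
    fix B assume "B \<in> {B. basis M B}"
    then have "basis M B" by simp
    then obtain \<F> Bs' Bs where "connected_filtration M \<F>" "minor_bases M \<F> Bs' Bs"
        "B = union_of_parts \<F> Bs' Bs"
      using ex_parts[OF assms] by blast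
    then show "B \<in> (\<Union>\<F> \<in> {\<F>. connected_filtration M \<F>}.
        {union_of_parts \<F> B' B | B' B. minor_bases M \<F> B' B})"
      by (intro UN_I[of \<F>] CollectI exI[of _ Bs'] exI[of _ Bs] conjI)
  next
    fix B assume "B \<in> (\<Union>\<F> \<in> {\<F>. connected_filtration M \<F>}.
        {union_of_parts \<F> B' B | B' B. minor_bases M \<F> B' B})"
    then obtain \<F> Bs' Bs where "connected_filtration M \<F>" "minor_bases M \<F> Bs' Bs"
        "B = union_of_parts \<F> Bs' Bs"
      by (elim UN_E CollectE exE conjE)
    then show "B \<in> {B. basis M B}" using parts by simp
  qed
  show "disjoint_family_on (\<lambda>\<F>. {union_of_parts \<F> B' B | B' B. minor_bases M \<F> B' B})
      {\<F>. connected_filtration M \<F>}"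
    unfolding disjoint_family_on_def
  proof (intro ballI impI equals0I)
    fix \<F> \<G> X
    assume F: "\<F> \<in> {\<F>. connected_filtration M \<F>}" "\<G> \<in> {\<F>. connected_filtration M \<F>}"
      and "\<F> \<noteq> \<G>"
      and X: "X \<in> {union_of_parts \<F> B' B | B' B. minor_bases M \<F> B' B} \<inter>
        {union_of_parts \<G> B' B | B' B. minor_bases M \<G> B' B}"
    \<comment> \<open>A common member \<open>X\<close> of two sets of the family determines both
      filtrations as its active filtration.\<close>
    have "\<F> = active_filtration M X" "\<G> = active_filtration M X"
    proof -
      obtain Bs' Bs Cs' Cs where \<F>: "minor_bases M \<F> Bs' Bs" "X = union_of_parts \<F> Bs' Bs"
        and \<G>: "minor_bases M \<G> Cs' Cs" "X = union_of_parts \<G> Cs' Cs"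
        using X by (elim IntE CollectE exE conjE)
      then show "\<F> = active_filtration M X" "\<G> = active_filtration M X"
        using parts[OF _ \<F>(1)] parts[OF _ \<G>(1)] F unfolding \<F>(2)[symmetric] \<G>(2)[symmetric]
        by simp_all
    qed
    then show False using \<open>\<F> \<noteq> \<G>\<close> by simp
  qed
  show "\<forall>F' Fc F Bs' Bs B.
      connected_filtration M (F', Fc, F) \<and> minor_bases M (F', Fc, F) Bs' Bs \<and>
      B = union_of_parts (F', Fc, F) Bs' Bs \<longrightarrow>
        parts_disjoint (F', Fc, F) Bs' Bs \<and>
        int_set M B = (\<Union>k \<in> {1..length F - 1}. {Min (F ! k - F ! (k - 1))}) \<and>
        int_set M B =
          (\<Union>k \<in> {1..length F - 1}. int_set (minor M (F ! k) (F ! (k - 1))) (Bs k)) \<and>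
        ext_set M B = (\<Union>k \<in> {1..length F' - 1}. {Min (F' ! (k - 1) - F' ! k)}) \<and>
        ext_set M B =
          (\<Union>k \<in> {1..length F' - 1}. ext_set (minor M (F' ! (k - 1)) (F' ! k)) (Bs' k)) \<and>
        (F', Fc, F) = active_filtration M B"
    by (intro allI impI, elim conjE, intro conjI) (rule parts_properties[OF assms]; assumption)+
qed

end
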